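(* Assume that $\Omega\subset\mathbb{R}^N$ is a bounded domain with Lipschitz boundary and that $A:\mathbb{R}^N\to\mathbb{R}^N$ is a (measurable) locally bounded function. Let $\{u_k\}_{k\in\mathbb{N}}$ be a bounded sequence in $BV_A(\Omega)$. Then, up to a subsequence, it converges strongly in $L^1(\Omega)$ to some function $u\in BV_A(\Omega)$.
   Context: For $u\in L^1(\Omega,\mathbb{C})$, let $$C_{1,A,u}(\Omega):=\sup\Big\{\int_\Omega \Re u\,\mathrm{div}\,\varphi-A\cdot\varphi\,\Im u\,dx : \varphi\in C_c^\infty(\Omega,\mathbb{R}^N),\ \|\varphi\|_{L^\infty(\Omega)}\le1\Big\},$$ $$C_{2,A,u}(\Omega):=\sup\Big\{\int_\Omega \Im u\,\mathrm{div}\,\varphi+A\cdot\varphi\,\Re u\,dx : \varphi\in C_c^\infty(\Omega,\mathbb{R}^N),\ \|\varphi\|_{L^\infty(\Omega)}\le1\Big\},$$ $|Du|_A(\Omega):=C_{1,A,u}(\Omega)+C_{2,A,u}(\Omega)$, and $BV_A(\Omega):=\{u\in L^1(\Omega,\mathbb{C}):|Du|_A(\Omega)<\infty\}$, normed by $\|u\|_{BV_A(\Omega)}:=\int_\Omega(|\Re u|+|\Im u|)\,dx+|Du|_A(\Omega)$. *)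

theory Defs
  imports "HOL-Analysis.Analysis" "HOL-Probability.Essential_Supremum"
begin

text \<open>Total differentiability is required at every order, as \<open>frechet_derivative\<close> is unspecified
  elsewhere; continuity of the lower-order derivatives follows from it.\<close>

primrec C_k :: "nat \<Rightarrow> ('a::euclidean_space \<Rightarrow> 'b::real_normed_vector) \<Rightarrow> bool" where
  "C_k 0 f \<longleftrightarrow> continuous_on UNIV f"
| "C_k (Suc k) f \<longleftrightarrow> (\<forall>x. f differentiable (at x)) \<and>
     (\<forall>b\<in>Basis. C_k k (\<lambda>x. frechet_derivative f (at x) b))"

text \<open>Functions with compact support in \<open>\<Omega>\<close> are identified with their extension by zero
  to the whole space.\<close>

definition Cc_infinity :: "'a::euclidean_space set \<Rightarrow> ('a \<Rightarrow> 'b::real_normed_vector) set" where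
  "Cc_infinity \<Omega> = {\<phi>. (\<forall>k. C_k k \<phi>) \<and>
     compact (closure {x. \<phi> x \<noteq> 0}) \<and> closure {x. \<phi> x \<noteq> 0} \<subseteq> \<Omega>}"

definition divergence :: "('a::euclidean_space \<Rightarrow> 'a) \<Rightarrow> 'a \<Rightarrow> real" where
  "divergence \<phi> x = (\<Sum>b\<in>Basis. frechet_derivative \<phi> (at x) b \<bullet> b)"

definition Linf_norm :: "'a::euclidean_space set \<Rightarrow> ('a \<Rightarrow> 'b::real_normed_vector) \<Rightarrow> ereal" where
  "Linf_norm \<Omega> \<phi> = esssup (lebesgue_on \<Omega>) (\<lambda>x. ereal (norm (\<phi> x)))"

definition test_fields :: "'a::euclidean_space set \<Rightarrow> ('a \<Rightarrow> 'a) set" where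
  "test_fields \<Omega> = {\<phi> \<in> Cc_infinity \<Omega>. Linf_norm \<Omega> \<phi> \<le> 1}"

definition C1_var :: "('a::euclidean_space \<Rightarrow> 'a) \<Rightarrow> 'a set \<Rightarrow> ('a \<Rightarrow> complex) \<Rightarrow> ereal" where
  "C1_var A \<Omega> u = (SUP \<phi>\<in>test_fields \<Omega>.
     ereal (LINT x:\<Omega>|lebesgue. Re (u x) * divergence \<phi> x - (A x \<bullet> \<phi> x) * Im (u x)))"

definition C2_var :: "('a::euclidean_space \<Rightarrow> 'a) \<Rightarrow> 'a set \<Rightarrow> ('a \<Rightarrow> complex) \<Rightarrow> ereal" where
  "C2_var A \<Omega> u = (SUP \<phi>\<in>test_fields \<Omega>.
     ereal (LINT x:\<Omega>|lebesgue. Im (u x) * divergence \<phi> x + (A x \<bullet> \<phi> x) * Re (u x)))"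

definition magnetic_variation ::
    "('a::euclidean_space \<Rightarrow> 'a) \<Rightarrow> 'a set \<Rightarrow> ('a \<Rightarrow> complex) \<Rightarrow> ereal" where
  "magnetic_variation A \<Omega> u = C1_var A \<Omega> u + C2_var A \<Omega> u"

text \<open>Elements of \<open>BV_A(\<Omega>)\<close> are represented by functions on the whole space, of which only the
  values on \<open>\<Omega>\<close> matter; almost everywhere equal functions are not identified.\<close>

definition BV :: "('a::euclidean_space \<Rightarrow> 'a) \<Rightarrow> 'a set \<Rightarrow> ('a \<Rightarrow> complex) set" where
  "BV A \<Omega> = {u. set_integrable lebesgue \<Omega> u \<and> magnetic_variation A \<Omega> u < \<infinity>}"

definition BV_norm :: "('a::euclidean_space \<Rightarrow> 'a) \<Rightarrow> 'a set \<Rightarrow> ('a \<Rightarrow> complex) \<Rightarrow> ereal" where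
  "BV_norm A \<Omega> u =
     ereal (LINT x:\<Omega>|lebesgue. \<bar>Re (u x)\<bar> + \<bar>Im (u x)\<bar>) + magnetic_variation A \<Omega> u"

text \<open>Near each boundary point, \<open>\<Omega>\<close> is the strict supergraph of a Lipschitz function in some
  orthonormal coordinate system. The unit vector \<open>e\<close> is the last coordinate direction,
  and \<open>g\<close>, a function of the other coordinates, lives on the hyperplane orthogonal to \<open>e\<close>.\<close>

definition Lipschitz_boundary :: "'a::euclidean_space set \<Rightarrow> bool" where
  "Lipschitz_boundary \<Omega> \<longleftrightarrow>
     (\<forall>x0\<in>frontier \<Omega>. \<exists>r>0. \<exists>e L. \<exists>g :: 'a \<Rightarrow> real.
        norm e = 1 \<and> L-lipschitz_on {z. z \<bullet> e = 0} g \<and>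
        \<Omega> \<inter> ball x0 r = {y \<in> ball x0 r. y \<bullet> e > g (y - (y \<bullet> e) *\<^sub>R e)})"

definition locally_bounded :: "('a::topological_space \<Rightarrow> 'b::metric_space) \<Rightarrow> bool" where
  "locally_bounded f \<longleftrightarrow> (\<forall>x. \<exists>U. open U \<and> x \<in> U \<and> bounded (f ` U))"

end

theory Submission
  imports Defs "HOL-Complex_Analysis.Great_Picard"
begin

text \<open>Since \<open>A\<close> is bounded on \<open>\<Omega>\<close>, the zeroth-order terms are controlled by the \<open>L\<^sup>1\<close> norm, so the real and
  the imaginary part of \<open>u\<^sub>k\<close> are bounded in the ordinary \<open>BV(\<Omega>)\<close>. Testing a translated difference
  against smooth cutoffs gives \<open>\<integral>\<^sub>W \<bar>f(x + h) - f(x)\<bar> dx \<le> \<bar>h\<bar> V\<close> whenever the segments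
  from \<open>W\<close> to \<open>W + h\<close> stay in \<open>\<Omega>\<close>. No extension operator is needed: near a Lipschitz
  boundary a thin strip has many disjoint inward translates, on which \<open>f\<close> has nearly the same mass, so
  mass cannot concentrate at the boundary, uniformly in \<open>f\<close>. Away from the boundary \<open>f\<close> is uniformly
  \<open>L\<^sup>1\<close>-close to its local averages, which are equi-Lipschitz; a diagonal subsequence makes all of them
  converge, and the sequence itself is then Cauchy in \<open>L\<^sup>1\<close>. The variation is lower semicontinuous.\<close>

subsection \<open>Smooth functions\<close>

text \<open>The translation estimate moves f only along segments inside \<Omega>, so every place
  needs an admissible direction. In the interior any shift shorter than the distance to the boundary
  will do. Near the boundary the shift follows the axis e of a graph chart, since moving upward
  keeps a point above the graph; this is where the shape of the boundary enters. The L^1 bound alone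
  would allow all mass to sit in a thin strip. The variation bound forces the translates of such a
  strip to carry nearly the same mass, and many disjoint translates would then exceed M. The two
  errors compete: M/m asks for many translates, m a V for a short total displacement. So the number
  m is fixed first and the thickness a afterwards. All choices depend on f only through M and V,
  which makes them uniform along the sequence. The variation sees smooth fields only, while the sign
  of f(x + h) - f(x) is merely measurable. The gap is closed by two dominated limits: smooth cutoffs
  tend to indicators of open sets, and these tend to indicators of G_delta sets.\<close>

lemma C_k_Suc_iff:
  assumes "\<And>x. (f has_derivative f' x) (at x)"
  shows "C_k (Suc k) f \<longleftrightarrow> (\<forall>b\<in>Basis. C_k k (\<lambda>x. f' x b))"
proof -
  \<comment> \<open>\<open>frechet_derivative\<close> is defined by choice; uniqueness of the
    derivative identifies it with the explicit \<open>f'\<close>, so the inductions below can work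
    with concrete derivatives.\<close>
  have "\<And>x. frechet_derivative f (at x) = f' x"
    using frechet_derivative_at[OF assms] by simp
  moreover have "\<And>x. f differentiable (at x)"
    using assms by (auto simp: differentiable_def)
  ultimately show ?thesis by simp
qed

lemma C_k_const: "C_k k (\<lambda>x. c)"
  by (induction k arbitrary: c) auto

text \<open>\<open>C_k (Suc k)\<close> mentions continuity only at the bottom of the recursion; the
  base case is that differentiability implies continuity.\<close>

lemma C_k_SucD: "C_k (Suc k) f \<Longrightarrow> C_k k f"
proof (induction k arbitrary: f)
  case 0
  then show ?case
    by (auto intro!: continuous_at_imp_continuous_on differentiable_imp_continuous_within)
next
  case (Suc k)
  then show ?case by (metis C_k.simps(2))
qed

lemma C_k_Suc_derivative:
  assumes "C_k (Suc k) f"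
  shows "(f has_derivative frechet_derivative f (at x)) (at x)"
  using assms by (auto simp: frechet_derivative_works)

lemma C_k_add: "C_k k f \<Longrightarrow> C_k k g \<Longrightarrow> C_k k (\<lambda>x. f x + g x)"
proof (induction k arbitrary: f g)
  case 0
  then show ?case by (auto intro: continuous_intros)
next
  case (Suc k)
  show ?case
    by (subst C_k_Suc_iff[OF has_derivative_add[OF C_k_Suc_derivative C_k_Suc_derivative], OF Suc.prems])
       (use Suc in auto)
qed

lemma C_k_sum: "(\<And>i. i \<in> I \<Longrightarrow> C_k k (f i)) \<Longrightarrow> C_k k (\<lambda>x. \<Sum>i\<in>I. f i x)"
  by (induction I rule: infinite_finite_induct) (auto intro: C_k_const C_k_add)

lemma C_k_bounded_linear:
  assumes "bounded_linear L"
  shows "C_k k f \<Longrightarrow> C_k k (\<lambda>x. L (f x))"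
proof (induction k arbitrary: f)
  case 0
  then show ?case
    by (auto intro: linear_continuous_on_compose bounded_linear.continuous_on[OF assms])
next
  case (Suc k)
  show ?case
    by (subst C_k_Suc_iff[OF bounded_linear.has_derivative[OF assms C_k_Suc_derivative], OF Suc.prems])
       (use Suc in auto)
qed

lemma C_k_bilinear:
  assumes "bounded_bilinear B"
  shows "C_k k f \<Longrightarrow> C_k k g \<Longrightarrow> C_k k (\<lambda>x. B (f x) (g x))"
proof (induction k arbitrary: f g)
  case 0
  then show ?case
    by (auto intro: bounded_bilinear.continuous_on[OF assms])
next
  case (Suc k)
  have "C_k k f" "C_k k g" using Suc.prems C_k_SucD by blast+
  then show ?case
    by (subst C_k_Suc_iff[OF bounded_bilinear.FDERIV[OF assms C_k_Suc_derivative C_k_Suc_derivative], OF Suc.prems])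
       (use Suc in \<open>auto intro!: C_k_add\<close>)
qed

lemma C_k_ident: "C_k k (\<lambda>x. x)"
proof (cases k)
  case 0
  then show ?thesis by simp
next
  case (Suc j)
  show ?thesis unfolding Suc
    by (subst C_k_Suc_iff[OF has_derivative_ident]) (auto intro: C_k_const)
qed

lemma C_k_translate: "C_k k f \<Longrightarrow> C_k k (\<lambda>x. f (x - a))"
proof (induction k arbitrary: f)
  case 0
  then show ?case
    by (auto intro!: continuous_on_compose2[of UNIV f] continuous_intros)
next
  case (Suc k)
  have "((\<lambda>x. f (x - a)) has_derivative frechet_derivative f (at (x - a))) (at x)" for x
  proof -
    have "((\<lambda>x. x - a) has_derivative (\<lambda>h. h)) (at x)"
      by (auto intro!: derivative_eq_intros)
    from has_derivative_compose[OF this C_k_Suc_derivative[OF Suc.prems]] show ?thesis .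
  qed
  from C_k_Suc_iff[OF this] Suc show ?case by auto
qed

text \<open>A general chain rule for higher orders is avoided: the derivative of \<open>F n\<close>
  after \<open>q\<close> is a derivative of \<open>q\<close> times \<open>F (Suc n)\<close> after
  \<open>q\<close>, the same shape one index higher, so the induction keeps \<open>n\<close>
  arbitrary.\<close>

lemma C_k_compose_derivatives:
  fixes F :: "nat \<Rightarrow> real \<Rightarrow> real"
  assumes F: "\<And>n t. (F n has_field_derivative F (Suc n) t) (at t)"
  shows "C_k k q \<Longrightarrow> C_k k (\<lambda>x. F n (q x))"
proof (induction k arbitrary: n)
  case 0
  have "continuous_on UNIV (F n)"
    using F by (meson DERIV_continuous continuous_at_imp_continuous_on)
  with 0 show ?case
    by (auto intro: continuous_on_compose2)
next
  case (Suc k)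
  have "((\<lambda>x. F n (q x)) has_derivative (\<lambda>h. frechet_derivative q (at x) h * F (Suc n) (q x))) (at x)" for x
    using DERIV_compose_FDERIV[OF F C_k_Suc_derivative[OF Suc.prems]] .
  from C_k_Suc_iff[OF this] show ?case
    using Suc C_k_SucD[OF Suc.prems] by (auto intro!: C_k_bilinear[OF bounded_bilinear_mult])
qed

text \<open>The functions \<open>P(1/t) e\<^sup>-\<^sup>1\<^sup>/\<^sup>t\<close>, \<open>P\<close> a polynomial, are closed under differentiation; this makes
  \<open>e\<^sup>-\<^sup>1\<^sup>/\<^sup>t\<close> smooth.\<close>

definition flat :: "real poly \<Rightarrow> real \<Rightarrow> real" where
  "flat P t = (if t \<le> 0 then 0 else poly P (1 / t) * exp (- 1 / t))"

lemma flat_tendsto_0: "(flat P \<longlongrightarrow> 0) (at_right 0)"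
proof -
  have "((\<lambda>s::real. \<Sum>i\<le>degree P. coeff P i * (s ^ i / exp s)) \<longlongrightarrow> (\<Sum>i\<le>degree P. coeff P i * 0)) at_top"
    by (intro tendsto_intros tendsto_power_div_exp_0)
  then have "((\<lambda>s::real. poly P s * exp (- s)) \<longlongrightarrow> 0) at_top"
    by (simp add: poly_altdef sum_distrib_right exp_minus divide_inverse mult.assoc)
  then have "((\<lambda>t. poly P (inverse t) * exp (- inverse t)) \<longlongrightarrow> 0) (at_right 0)"
    by (rule filterlim_compose) (rule filterlim_inverse_at_top_right)
  then show ?thesis
    by (rule Lim_transform_eventually)
      (auto simp: eventually_at_filter flat_def field_simps)
qed

text \<open>With s = 1/t one has ds/dt = - s^2, and P(s) e^(-s) has s-derivative (P' - P)(s) e^(-s);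
  the product is s^2 (P - P')(s) e^(-s), and \<open>[:0, 0, 1:]\<close> is s^2.\<close>

lemma flat_has_field_derivative:
  "(flat P has_field_derivative flat ([:0, 0, 1:] * (P - pderiv P)) t) (at t)"
proof (cases t "0::real" rule: linorder_cases)
  case less
  have "((\<lambda>_. 0) has_field_derivative 0) (at t)" by simp
  then show ?thesis
    using less by (rule_tac has_field_derivative_transform_within_open[of "\<lambda>_. 0" _ _ "{..<0}"])
      (auto simp: flat_def)
next
  case equal
  \<comment> \<open>For h > 0, dividing by h multiplies the polynomial by its variable, so the
    difference quotient at 0 is again a flat function, namely
    \<open>flat (pCons 0 P)\<close>.\<close>
  have "((\<lambda>h. flat P h / h) \<longlongrightarrow> 0) (at_right 0)"
    by (rule Lim_transform_eventually[OF flat_tendsto_0[of "pCons 0 P"]])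
      (auto simp: eventually_at_filter flat_def)
  moreover have "((\<lambda>h. flat P h / h) \<longlongrightarrow> 0) (at_left 0)"
    by (rule Lim_transform_eventually[OF tendsto_const])
      (auto simp: eventually_at_filter flat_def)
  ultimately have "((\<lambda>h. flat P h / h) \<longlongrightarrow> 0) (at 0)"
    by (simp add: filterlim_split_at)
  then show ?thesis
    by (simp add: equal DERIV_def) (simp add: flat_def)
next
  case greater
  have "((\<lambda>t. poly P (1 / t) * exp (- 1 / t)) has_field_derivative
      flat ([:0, 0, 1:] * (P - pderiv P)) t) (at t)"
    using greater
    by (auto intro!: derivative_eq_intros DERIV_chain'[OF _ poly_DERIV] simp: flat_def field_simps power2_eq_square)
  then show ?thesis
    using greater by (rule_tac has_field_derivative_transform_within_open[of "\<lambda>t. poly P (1 / t) * exp (- 1 / t)" _ _ "{0<..}"])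
      (auto simp: flat_def)
qed

lemma flat_nonneg: "0 \<le> flat 1 t" and flat_pos_iff: "0 < flat 1 t \<longleftrightarrow> 0 < t"
  by (auto simp: flat_def)

lemma C_k_flat: "C_k k q \<Longrightarrow> C_k k (\<lambda>x. flat 1 (q x))"
proof -
  \<comment> \<open>\<open>flat (P n)\<close> is the n-th derivative of
    \<open>flat 1\<close>.\<close>
  define P :: "nat \<Rightarrow> real poly" where "P = rec_nat 1 (\<lambda>_ P. [:0, 0, 1:] * (P - pderiv P))"
  have "(flat (P n) has_field_derivative flat (P (Suc n)) t) (at t)" for n t
    using flat_has_field_derivative[of "P n" t] by (simp add: P_def)
  from C_k_compose_derivatives[of "\<lambda>n. flat (P n)", OF this, of k q 0] show "C_k k q \<Longrightarrow> ?thesis"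
    by (simp add: P_def)
qed

lemma C_k_exp: "C_k k q \<Longrightarrow> C_k k (\<lambda>x. exp (q x :: real))"
  using C_k_compose_derivatives[of "\<lambda>_. exp"] DERIV_exp by blast

section \<open>Bumps on balls and smooth cutoffs of open sets\<close>

definition bump :: "'a::euclidean_space \<Rightarrow> real \<Rightarrow> 'a \<Rightarrow> real" where
  "bump c r x = flat 1 (r\<^sup>2 - (x - c) \<bullet> (x - c))"

text \<open>The squared distance to the centre is a polynomial in x, so the bump has no corner
  there.\<close>

lemma C_k_bump: "C_k k (bump c r)"
proof -
  have sub: "C_k k (\<lambda>x. x - c)" for c :: 'a
    using C_k_translate[OF C_k_ident] .
  have "C_k k (\<lambda>x. r\<^sup>2 + - ((x - c) \<bullet> (x - c)))"
    by (intro C_k_add C_k_const C_k_bounded_linear[OF bounded_linear_minus[OF bounded_linear_ident]]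
        C_k_bilinear[OF bounded_bilinear_inner] sub)
  from C_k_flat[OF this] show ?thesis
    unfolding bump_def[abs_def] by simp
qed

lemma bump_nonneg: "0 \<le> bump c r x"
  by (simp add: bump_def flat_nonneg)

lemma bump_pos_iff: "0 < r \<Longrightarrow> 0 < bump c r x \<longleftrightarrow> x \<in> ball c r"
proof -
  assume "0 < r"
  have "(x - c) \<bullet> (x - c) < r\<^sup>2 \<longleftrightarrow> norm (x - c) < r"
    using \<open>0 < r\<close> by (simp add: dot_square_norm power_mono_iff flip: not_le)
  then show ?thesis
    by (simp add: bump_def flat_pos_iff dist_norm norm_minus_commute)
qed

lemma smooth_cutoffs:
  fixes W :: "'a::euclidean_space set"
  assumes "open W"
  obtains \<psi> :: "nat \<Rightarrow> 'a \<Rightarrow> real" where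
    "\<And>n. \<psi> n \<in> Cc_infinity W"
    "\<And>n x. 0 \<le> \<psi> n x" "\<And>n x. \<psi> n x \<le> 1"
    "\<And>x. (\<lambda>n. \<psi> n x) \<longlonglongrightarrow> indicator W x"
proof -
  (* W is a union of balls B_i whose closures lie in W, with bumps b_i; take
     psi_n = 1 - exp (- n (b_0 + ... + b_(n-1))). *)
  show thesis
  proof (cases "W = {}")
    case True
    then show ?thesis
      by (intro that[of "\<lambda>_ _. 0"]) (auto simp: Cc_infinity_def C_k_const)
  next
    case False
    define \<B> where "\<B> = {B. \<exists>c r. 0 < r \<and> B = ball c r \<and> cball c r \<subseteq> W}"
    have "\<Union>\<B> = W"
      using open_contains_cball[of W] \<open>open W\<close> unfolding \<B>_def
      by (auto simp: subset_iff) (metis centre_in_ball)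
    moreover obtain \<B>' where B': "\<B>' \<subseteq> \<B>" "countable \<B>'" "\<Union>\<B>' = \<Union>\<B>"
      by (rule Lindelof[of \<B>]) (auto simp: \<B>_def)
    ultimately have W: "\<Union>\<B>' = W" and "\<B>' \<noteq> {}" using False by auto
    have range: "range (from_nat_into \<B>') = \<B>'"
      using range_from_nat_into[OF \<open>\<B>' \<noteq> {}\<close> B'(2)] .
    have "\<exists>c r. 0 < r \<and> from_nat_into \<B>' i = ball c r \<and> cball c r \<subseteq> W" for i
      using from_nat_into[OF \<open>\<B>' \<noteq> {}\<close>, of i] B'(1) unfolding \<B>_def by auto
    then obtain c r where cr: "\<And>i. 0 < r i" "\<And>i. from_nat_into \<B>' i = ball (c i) (r i)"
      "\<And>i. cball (c i) (r i) \<subseteq> W"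
      by metis
    define S where "S n x = (\<Sum>i<n. bump (c i) (r i) x)" for n x
    have S_nonneg: "0 \<le> S n x" for n x
      by (simp add: S_def bump_nonneg sum_nonneg)
    define \<psi> where "\<psi> n x = 1 - exp (- (real n * S n x))" for n x
    show ?thesis
    proof
      fix n x
      show "0 \<le> \<psi> n x" "\<psi> n x \<le> 1"
        using S_nonneg[of n x] by (auto simp: \<psi>_def)
    next
      fix n
      have smooth: "C_k k (\<lambda>x. 1 + (- exp (- real n * S n x)))" for k
        unfolding S_def
        by (intro C_k_add C_k_const C_k_bounded_linear[OF bounded_linear_minus[OF bounded_linear_ident]] C_k_exp
            C_k_bounded_linear[OF bounded_linear_mult_right] C_k_sum C_k_bump)
      \<comment> \<open>Only finitely many bumps enter \<psi> n, so its support lies in a finite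
        union of closed balls. That union is compact and contained in W, which is why the closures
        of the chosen balls had to lie in W.\<close>
      have supp: "closure {x. \<psi> n x \<noteq> 0} \<subseteq> (\<Union>i<n. cball (c i) (r i))"
      proof (rule closure_minimal)
        show "{x. \<psi> n x \<noteq> 0} \<subseteq> (\<Union>i<n. cball (c i) (r i))"
        proof (rule ccontr)
          assume "\<not> ?thesis"
          then obtain x where x: "\<psi> n x \<noteq> 0" "\<And>i. i < n \<Longrightarrow> x \<notin> ball (c i) (r i)"
            using ball_subset_cball by blast
          then have "bump (c i) (r i) x = 0" if "i < n" for i
            using that bump_pos_iff[OF cr(1), of "c i" i x] bump_nonneg[of "c i" "r i" x] by force
          then have "S n x = 0" by (simp add: S_def)
          with x(1) show False by (simp add: \<psi>_def)
        qed
      qed (auto intro: closed_UN)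
      have "compact (\<Union>i<n. cball (c i) (r i))"
        by (auto intro: compact_UN)
      from compact_Int_closed[OF this closed_closure[of "{x. \<psi> n x \<noteq> 0}"]] supp
      have "compact (closure {x. \<psi> n x \<noteq> 0})"
        by (simp add: Int_absorb1)
      moreover have "(\<Union>i<n. cball (c i) (r i)) \<subseteq> W"
        using cr(3) by blast
      ultimately show "\<psi> n \<in> Cc_infinity W"
        using smooth supp unfolding Cc_infinity_def \<psi>_def[abs_def] by auto
    next
      fix x
      show "(\<lambda>n. \<psi> n x) \<longlonglongrightarrow> indicator W x"
      proof (cases "x \<in> W")
        case True
        then obtain i where "x \<in> ball (c i) (r i)"
          using W range cr(2) by (metis UnionE imageE)
        then have pos: "0 < bump (c i) (r i) x"
          using bump_pos_iff[OF cr(1)] by blast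
        \<comment> \<open>The partial sums S n x may stay bounded; the factor n is what sends the
          exponent to infinity as soon as a single bump is positive at x.\<close>
        have "filterlim (\<lambda>n. real n * bump (c i) (r i) x) at_top sequentially"
          using filterlim_tendsto_pos_mult_at_top[OF tendsto_const pos filterlim_real_sequentially]
          by (simp add: mult.commute)
        moreover have "\<forall>\<^sub>F n in sequentially. real n * bump (c i) (r i) x \<le> real n * S n x"
          using eventually_gt_at_top[of i]
        proof eventually_elim
          case (elim n)
          then show ?case
            unfolding S_def by (intro mult_left_mono member_le_sum) (auto intro: bump_nonneg)
        qed
        ultimately have "filterlim (\<lambda>n. real n * S n x) at_top sequentially"
          by (rule filterlim_at_top_mono)
        then have "(\<lambda>n. exp (- (real n * S n x))) \<longlonglongrightarrow> 0"
          by (intro filterlim_compose[OF exp_at_bot] filterlim_uminus_at_top[THEN iffD1])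
        from tendsto_diff[OF tendsto_const this, of 1] True show ?thesis
          by (simp add: \<psi>_def)
      next
        case False
        then have "bump (c i) (r i) x = 0" for i
          using bump_pos_iff[OF cr(1), of "c i" i x] bump_nonneg[of "c i" "r i" x] cr(3)[of i]
          by force
        then show ?thesis using False by (simp add: \<psi>_def S_def)
      qed
    qed
  qed
qed

subsection \<open>Test functions\<close>

lemma Cc_infinity_mono: "U \<subseteq> W \<Longrightarrow> Cc_infinity U \<subseteq> Cc_infinity W"
  by (auto simp: Cc_infinity_def)

lemma Cc_infinity_diff:
  assumes "f \<in> Cc_infinity W" "g \<in> Cc_infinity W"
  shows "(\<lambda>x. f x - g x) \<in> Cc_infinity W"
proof -
  have "C_k k (\<lambda>x. f x + - g x)" for k
    using assms unfolding Cc_infinity_def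
    by (intro C_k_add C_k_bounded_linear[OF bounded_linear_minus[OF bounded_linear_ident]]) auto
  moreover have supp: "closure {x. f x - g x \<noteq> 0} \<subseteq> closure {x. f x \<noteq> 0} \<union> closure {x. g x \<noteq> 0}"
    unfolding closure_Un[symmetric] by (rule closure_mono) auto
  moreover have "compact (closure {x. f x \<noteq> 0} \<union> closure {x. g x \<noteq> 0})"
    using assms by (auto simp: Cc_infinity_def)
  from compact_Int_closed[OF this closed_closure[of "{x. f x - g x \<noteq> 0}"]] supp
  have "compact (closure {x. f x - g x \<noteq> 0})"
    by (simp add: Int_absorb1)
  ultimately show ?thesis
    using assms by (auto simp: Cc_infinity_def)
qed

lemma Cc_infinity_continuous: "\<phi> \<in> Cc_infinity W \<Longrightarrow> continuous_on UNIV \<phi>"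
  unfolding Cc_infinity_def using C_k.simps(1) by blast

lemma Cc_infinity_has_derivative:
  "\<phi> \<in> Cc_infinity W \<Longrightarrow> (\<phi> has_derivative frechet_derivative \<phi> (at x)) (at x)"
  unfolding Cc_infinity_def by (auto intro!: C_k_Suc_derivative[of 0] simp del: C_k.simps)

lemma Cc_infinity_derivative_continuous:
  assumes "\<phi> \<in> Cc_infinity W"
  shows "continuous_on UNIV (\<lambda>x. frechet_derivative \<phi> (at x) h)"
proof -
  have "C_k (Suc 0) \<phi>" using assms unfolding Cc_infinity_def by blast
  then have cont: "continuous_on UNIV (\<lambda>x. frechet_derivative \<phi> (at x) b)" if "b \<in> Basis" for b
    using that by simp
  \<comment> \<open>\<open>C_k\<close> controls derivatives along basis vectors only; linearity in h
    extends this to every direction.\<close>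
  have "frechet_derivative \<phi> (at x) h = (\<Sum>b\<in>Basis. (h \<bullet> b) *\<^sub>R frechet_derivative \<phi> (at x) b)" for x
  proof -
    have lin: "linear (frechet_derivative \<phi> (at x))"
      using has_derivative_linear[OF Cc_infinity_has_derivative[OF assms]] .
    have "frechet_derivative \<phi> (at x) h = frechet_derivative \<phi> (at x) (\<Sum>b\<in>Basis. (h \<bullet> b) *\<^sub>R b)"
      by (simp add: euclidean_representation)
    then show ?thesis
      using lin by (simp add: linear_sum linear_scale)
  qed
  then show ?thesis
    using cont by (auto intro!: continuous_intros)
qed

lemma Cc_infinity_derivative_eq_0:
  assumes "x \<notin> closure {x. \<phi> x \<noteq> 0}"
  shows "frechet_derivative \<phi> (at x) h = 0"
proof -
  have "((\<lambda>_. 0) has_derivative (\<lambda>_. 0)) (at x)" by simp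
  then have "(\<phi> has_derivative (\<lambda>_. 0)) (at x)"
    by (rule has_derivative_transform_within_open[of _ _ _ _ "- closure {x. \<phi> x \<noteq> 0}"])
       (use assms closure_subset[of "{x. \<phi> x \<noteq> 0}"] in auto)
  from frechet_derivative_at[OF this] show ?thesis by metis
qed

lemma continuous_compact_support_bounded:
  fixes g :: "'a::euclidean_space \<Rightarrow> 'b::real_normed_vector"
  assumes "continuous_on UNIV g" "compact K" "\<And>x. x \<notin> K \<Longrightarrow> g x = 0"
  obtains B where "0 \<le> B" "\<And>x. norm (g x) \<le> B"
proof -
  have "bounded (g ` K)"
    using assms by (intro compact_imp_bounded compact_continuous_image) (auto intro: continuous_on_subset)
  then obtain B where "\<And>x. x \<in> K \<Longrightarrow> norm (g x) \<le> B"
    by (auto simp: bounded_iff)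
  then have "norm (g x) \<le> max 0 B" for x
    using assms(3)[of x] by (cases "x \<in> K") (auto intro: max.coboundedI2)
  then show thesis by (intro that[of "max 0 B"]) auto
qed

lemma Cc_infinity_bounded:
  assumes "\<phi> \<in> Cc_infinity W"
  obtains B where "0 \<le> B" "\<And>x. norm (\<phi> x) \<le> B"
proof (rule continuous_compact_support_bounded[OF Cc_infinity_continuous[OF assms]])
  show "compact (closure {x. \<phi> x \<noteq> 0})" using assms by (auto simp: Cc_infinity_def)
  show "\<phi> x = 0" if "x \<notin> closure {x. \<phi> x \<noteq> 0}" for x
    using that closure_subset[of "{x. \<phi> x \<noteq> 0}"] by auto
qed (use that in blast)

lemma Cc_infinity_derivative_bounded:
  assumes "\<phi> \<in> Cc_infinity W"
  obtains B where "0 \<le> B" "\<And>x. norm (frechet_derivative \<phi> (at x) h) \<le> B"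
proof (rule continuous_compact_support_bounded[OF Cc_infinity_derivative_continuous[OF assms]])
  show "compact (closure {x. \<phi> x \<noteq> 0})" using assms by (auto simp: Cc_infinity_def)
qed (use that Cc_infinity_derivative_eq_0 in blast)+

lemma divergence_continuous:
  "\<phi> \<in> Cc_infinity W \<Longrightarrow> continuous_on UNIV (divergence \<phi>)"
  unfolding divergence_def[abs_def]
  by (intro continuous_intros Cc_infinity_derivative_continuous)

lemma divergence_bounded:
  assumes "\<phi> \<in> Cc_infinity W"
  obtains B where "0 \<le> B" "\<And>x. \<bar>divergence \<phi> x\<bar> \<le> B"
proof (rule continuous_compact_support_bounded[OF divergence_continuous[OF assms]])
  show "compact (closure {x. \<phi> x \<noteq> 0})" using assms by (auto simp: Cc_infinity_def)
  show "divergence \<phi> x = 0" if "x \<notin> closure {x. \<phi> x \<noteq> 0}" for x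
    using Cc_infinity_derivative_eq_0[OF that] by (simp add: divergence_def)
qed (use that in auto)

section \<open>L^1 norms by duality with smooth test functions\<close>

lemma integrable_mult_bounded:
  fixes f g :: "'a \<Rightarrow> real"
  assumes "integrable M f" "g \<in> borel_measurable M" "\<And>x. x \<in> space M \<Longrightarrow> \<bar>g x\<bar> \<le> B"
  shows "integrable M (\<lambda>x. f x * g x)"
proof (rule Bochner_Integration.integrable_bound)
  show "integrable M (\<lambda>x. B * f x)" using assms by simp
  show "AE x in M. norm (f x * g x) \<le> norm (B * f x)"
  proof (rule AE_I2)
    fix x assume "x \<in> space M"
    then have "\<bar>g x\<bar> \<le> \<bar>B\<bar>" using assms(3)[of x] by linarith
    then show "norm (f x * g x) \<le> norm (B * f x)"
      using mult_right_mono[of "\<bar>g x\<bar>" "\<bar>B\<bar>" "\<bar>f x\<bar>"] by (simp add: abs_mult mult.commute)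
  qed
qed (use assms in measurable)

(* A difference of two cutoffs is bounded by 1 even if their supports overlap. *)
lemma integral_cutoff_diff_le:
  fixes g :: "'a::euclidean_space \<Rightarrow> real"
  assumes g: "integrable lborel g"
    and le: "\<And>\<psi>. \<psi> \<in> Cc_infinity W \<Longrightarrow> (\<And>x. \<bar>\<psi> x\<bar> \<le> 1) \<Longrightarrow> (LINT x|lborel. g x * \<psi> x) \<le> c"
    and "open U" "U \<subseteq> W" "open U'" "U' \<subseteq> W"
  shows "(LINT x|lborel. g x * (indicator U x - indicator U' x)) \<le> c"
proof -
  obtain \<psi> where \<psi>: "\<And>n. \<psi> n \<in> Cc_infinity U" "\<And>n x. 0 \<le> \<psi> n x" "\<And>n x. \<psi> n x \<le> 1"
    "\<And>x. (\<lambda>n. \<psi> n x :: real) \<longlonglongrightarrow> indicator U x"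
    using smooth_cutoffs[OF \<open>open U\<close>] by blast
  obtain \<eta> where \<eta>: "\<And>n. \<eta> n \<in> Cc_infinity U'" "\<And>n x. 0 \<le> \<eta> n x" "\<And>n x. \<eta> n x \<le> 1"
    "\<And>x. (\<lambda>n. \<eta> n x :: real) \<longlonglongrightarrow> indicator U' x"
    using smooth_cutoffs[OF \<open>open U'\<close>] by blast
  have [measurable]: "\<psi> n \<in> borel_measurable borel" "\<eta> n \<in> borel_measurable borel" for n
    using Cc_infinity_continuous \<psi>(1) \<eta>(1) borel_measurable_continuous_onI by blast+
  have [measurable]: "U \<in> sets borel" "U' \<in> sets borel" using assms by auto
  have [measurable]: "g \<in> borel_measurable borel" using g by auto
  have b: "\<bar>\<psi> n x - \<eta> n x\<bar> \<le> 1" for n x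
    using \<psi>(2,3)[of n x] \<eta>(2,3)[of n x] by linarith
  have "(\<lambda>n. LINT x|lborel. g x * (\<psi> n x - \<eta> n x)) \<longlonglongrightarrow> (LINT x|lborel. g x * (indicator U x - indicator U' x))"
  proof (rule integral_dominated_convergence[of _ _ _ "\<lambda>x. \<bar>g x\<bar>"])
    show "AE x in lborel. (\<lambda>n. g x * (\<psi> n x - \<eta> n x)) \<longlonglongrightarrow> g x * (indicator U x - indicator U' x)"
      using \<psi>(4) \<eta>(4) by (auto intro!: tendsto_intros)
    show "AE x in lborel. norm (g x * (\<psi> n x - \<eta> n x)) \<le> \<bar>g x\<bar>" for n
      using b[of n] by (auto simp: abs_mult intro!: mult_left_le)
  qed (use g in auto)
  moreover have "(LINT x|lborel. g x * (\<psi> n x - \<eta> n x)) \<le> c" for n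
    using \<psi>(1) \<eta>(1) b Cc_infinity_mono[OF \<open>U \<subseteq> W\<close>] Cc_infinity_mono[OF \<open>U' \<subseteq> W\<close>]
    by (intro le Cc_infinity_diff) blast+
  ultimately show ?thesis
    by (meson LIMSEQ_le_const2)
qed

text \<open>Regularity of Lebesgue measure encloses P in a G_delta set that exceeds it by a null
  set. Intersecting with W keeps the open sets where cutoffs are allowed, and finite intersections
  of the defining open sets decrease, so their indicators converge at every point.\<close>

lemma open_approximation:
  fixes P :: "'a::euclidean_space set"
  assumes "P \<in> sets borel" "P \<subseteq> W" "open W"
  obtains U C where "\<And>n::nat. open (U n)" "\<And>n. U n \<subseteq> W" "C \<in> sets borel"
    "\<And>x. (\<lambda>n. indicator (U n) x :: real) \<longlonglongrightarrow> indicator C x"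
    "AE x in lborel. x \<in> C \<longleftrightarrow> x \<in> P"
proof -
  have "P \<in> sets lebesgue" using assms by simp
  then obtain C T where C: "gdelta C" "T \<in> null_sets lebesgue" "P \<union> T = C"
    by (rule lebesgue_set_almost_gdelta)
  from C(1) obtain F where F: "\<And>n::nat. open (F n)" "C = \<Inter>(F ` UNIV)"
    by (auto elim: gdelta.cases)
  have "AE x in lebesgue. x \<in> C \<inter> W \<longleftrightarrow> x \<in> P"
    using AE_not_in[OF C(2)] by eventually_elim (use C(3) \<open>P \<subseteq> W\<close> in auto)
  then have "AE x in lborel. x \<in> C \<inter> W \<longleftrightarrow> x \<in> P"
    by (simp add: AE_completion_iff)
  moreover have "(\<lambda>n. indicator (W \<inter> (\<Inter>i\<le>n. F i)) x :: real) \<longlonglongrightarrow> indicator (C \<inter> W) x" for x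
  proof -
    have "decseq (\<lambda>n. W \<inter> (\<Inter>i\<le>n. F i))" by (fastforce simp: decseq_def)
    from LIMSEQ_indicator_decseq[OF this] have
      "(\<lambda>n. indicator (W \<inter> (\<Inter>i\<le>n. F i)) x :: real) \<longlonglongrightarrow> indicator (\<Inter>n. W \<inter> (\<Inter>i\<le>n. F i)) x" .
    also have "(\<Inter>n. W \<inter> (\<Inter>i\<le>n. F i)) = C \<inter> W" by (auto simp: F(2))
    finally show ?thesis .
  qed
  moreover have "C \<inter> W \<in> sets borel"
    using F \<open>open W\<close> by auto
  ultimately show thesis
    using F(1) \<open>open W\<close> by (intro that[of "\<lambda>n. W \<inter> (\<Inter>i\<le>n. F i)" "C \<inter> W"]) auto
qed

text \<open>On W the sign of g is, almost everywhere, the difference of the indicators of C and C',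
  the limit sets for {g > 0} and {g < 0}. The open sets U n and U' n may overlap, but the difference
  of their indicators stays in [-1, 1], so \<bar>g\<bar> dominates and the bound passes to the
  limit.\<close>

lemma L1_norm_le_by_test_functions:
  fixes g :: "'a::euclidean_space \<Rightarrow> real"
  assumes "open W" and g: "integrable lborel g"
    and le: "\<And>\<psi>. \<psi> \<in> Cc_infinity W \<Longrightarrow> (\<And>x. \<bar>\<psi> x\<bar> \<le> 1) \<Longrightarrow> (LINT x|lborel. g x * \<psi> x) \<le> c"
  shows "(LINT x|lborel. indicator W x * \<bar>g x\<bar>) \<le> c"
proof -
  have [measurable]: "g \<in> borel_measurable borel" "W \<in> sets borel" using g \<open>open W\<close> by auto
  have P: "{x \<in> W. 0 < g x} \<in> sets borel" "{x \<in> W. 0 < g x} \<subseteq> W"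
    and N: "{x \<in> W. g x < 0} \<in> sets borel" "{x \<in> W. g x < 0} \<subseteq> W" by auto
  obtain U C where U: "\<And>n::nat. open (U n)" "\<And>n. U n \<subseteq> W" "C \<in> sets borel"
    "\<And>x. (\<lambda>n. indicator (U n) x :: real) \<longlonglongrightarrow> indicator C x"
    "AE x in lborel. x \<in> C \<longleftrightarrow> x \<in> {x \<in> W. 0 < g x}"
    by (rule open_approximation[OF P \<open>open W\<close>]) (rule that)
  obtain U' C' where U': "\<And>n::nat. open (U' n)" "\<And>n. U' n \<subseteq> W" "C' \<in> sets borel"
    "\<And>x. (\<lambda>n. indicator (U' n) x :: real) \<longlonglongrightarrow> indicator C' x"
    "AE x in lborel. x \<in> C' \<longleftrightarrow> x \<in> {x \<in> W. g x < 0}"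
    by (rule open_approximation[OF N \<open>open W\<close>]) (rule that)
  have [measurable]: "U n \<in> sets borel" "U' n \<in> sets borel" for n
    using U(1) U'(1) by auto
  note [measurable] = U(3) U'(3)
  have "(\<lambda>n. LINT x|lborel. g x * (indicator (U n) x - indicator (U' n) x)) \<longlonglongrightarrow>
      (LINT x|lborel. g x * (indicator C x - indicator C' x))"
  proof (rule integral_dominated_convergence[of _ _ _ "\<lambda>x. \<bar>g x\<bar>"])
    show "AE x in lborel. (\<lambda>n. g x * (indicator (U n) x - indicator (U' n) x)) \<longlonglongrightarrow>
        g x * (indicator C x - indicator C' x)"
      using U(4) U'(4) by (auto intro!: tendsto_intros)
    show "AE x in lborel. norm (g x * (indicator (U n) x - indicator (U' n) x)) \<le> \<bar>g x\<bar>" for n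
      by (auto simp: indicator_def)
  qed (use g in auto)
  moreover have "(LINT x|lborel. g x * (indicator (U n) x - indicator (U' n) x)) \<le> c" for n
    by (rule integral_cutoff_diff_le[OF g le U(1,2) U'(1,2)])
  ultimately have "(LINT x|lborel. g x * (indicator C x - indicator C' x)) \<le> c"
    by (meson LIMSEQ_le_const2)
  moreover have "(LINT x|lborel. g x * (indicator C x - indicator C' x)) = (LINT x|lborel. indicator W x * \<bar>g x\<bar>)"
  proof (rule integral_cong_AE)
    show "AE x in lborel. g x * (indicator C x - indicator C' x) = indicator W x * \<bar>g x\<bar>"
      using U(5) U'(5) by eventually_elim (auto simp: indicator_def)
  qed measurable
  ultimately show ?thesis by simp
qed

subsection \<open>Translation estimates for functions of bounded variation\<close>

lemma
  fixes f :: "'a::euclidean_space \<Rightarrow> real"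
  assumes "f \<in> borel_measurable borel"
  shows lborel_integral_translate: "(LINT x|lborel. f (x + c)) = (LINT x|lborel. f x)"
    and lborel_integrable_translate_iff: "integrable lborel (\<lambda>x. f (x + c)) \<longleftrightarrow> integrable lborel f"
proof -
  have "(LINT x|lborel. f x) = (LINT x|distr lborel borel ((+) c). f x)"
    by (simp add: lborel_distr_plus)
  also have "\<dots> = (LINT x|lborel. f (c + x))"
    using assms by (intro integral_distr) auto
  finally show "(LINT x|lborel. f (x + c)) = (LINT x|lborel. f x)"
    by (simp add: add.commute)
  have "integrable lborel f \<longleftrightarrow> integrable (distr lborel borel ((+) c)) f"
    by (simp add: lborel_distr_plus)
  also have "\<dots> \<longleftrightarrow> integrable lborel (\<lambda>x. f (c + x))"
    using assms by (intro integrable_distr_eq) auto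
  finally show "integrable lborel (\<lambda>x. f (x + c)) \<longleftrightarrow> integrable lborel f"
    by (simp add: add.commute)
qed

text \<open>The real-valued functions of \<open>BV(\<Omega>)\<close>, extended by zero, with \<open>L\<^sup>1\<close> norm at most \<open>M\<close> and
  total variation at most \<open>V\<close>.\<close>

definition BV_class :: "'a::euclidean_space set \<Rightarrow> real \<Rightarrow> real \<Rightarrow> ('a \<Rightarrow> real) set" where
  "BV_class \<Omega> M V = {f. integrable lborel f \<and> (\<forall>x. x \<notin> \<Omega> \<longrightarrow> f x = 0) \<and> (LINT x|lborel. \<bar>f x\<bar>) \<le> M \<and>
     (\<forall>\<phi>\<in>Cc_infinity \<Omega>. (\<forall>x. norm (\<phi> x) \<le> 1) \<longrightarrow> (LINT x|lborel. f x * divergence \<phi> x) \<le> V)}"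

text \<open>A scalar test function times a constant vector is a field whose divergence is a
  directional derivative. This links the variation, which tests with divergences, to difference
  quotients in a single direction.\<close>

lemma Cc_infinity_translated_field:
  fixes \<psi> :: "'a::euclidean_space \<Rightarrow> real" and v :: 'a
  assumes \<psi>: "\<psi> \<in> Cc_infinity W" and W: "\<And>x. x \<in> W \<Longrightarrow> x + a \<in> \<Omega>"
  defines "\<phi> \<equiv> \<lambda>x. \<psi> (x - a) *\<^sub>R v"
  shows "\<phi> \<in> Cc_infinity \<Omega>" and "divergence \<phi> x = frechet_derivative \<psi> (at (x - a)) v"
proof -
  have "C_k k \<phi>" for k
    using \<psi> unfolding \<phi>_def Cc_infinity_def
    by (intro C_k_bounded_linear[OF bounded_linear_scaleR_left] C_k_translate) auto
  moreover have supp: "closure {x. \<phi> x \<noteq> 0} \<subseteq> (+) a ` closure {x. \<psi> x \<noteq> 0}"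
  proof -
    have "{x. \<phi> x \<noteq> 0} \<subseteq> (+) a ` {x. \<psi> x \<noteq> 0}"
      by (force simp: \<phi>_def image_iff intro: exI[of _ "x - a" for x])
    then show ?thesis by (metis closure_mono closure_translation)
  qed
  moreover have "compact ((+) a ` closure {x. \<psi> x \<noteq> 0})"
    using \<psi> by (auto simp: Cc_infinity_def intro: compact_translation)
  from compact_Int_closed[OF this closed_closure[of "{x. \<phi> x \<noteq> 0}"]] supp
  have "compact (closure {x. \<phi> x \<noteq> 0})"
    by (simp add: Int_absorb1)
  moreover have "(+) a ` closure {x. \<psi> x \<noteq> 0} \<subseteq> \<Omega>"
    using \<psi> W by (auto simp: Cc_infinity_def add.commute)
  ultimately show "\<phi> \<in> Cc_infinity \<Omega>"
    unfolding Cc_infinity_def by blast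
  have "((\<lambda>x. x - a) has_derivative (\<lambda>h. h)) (at x)"
    by (auto intro!: derivative_eq_intros)
  from has_derivative_compose[OF this Cc_infinity_has_derivative[OF \<psi>]]
  have "(\<phi> has_derivative (\<lambda>h. frechet_derivative \<psi> (at (x - a)) h *\<^sub>R v)) (at x)"
    unfolding \<phi>_def by (intro has_derivative_scaleR_left)
  then have "frechet_derivative \<phi> (at x) = (\<lambda>h. frechet_derivative \<psi> (at (x - a)) h *\<^sub>R v)"
    by (metis frechet_derivative_at)
  then have "divergence \<phi> x = (\<Sum>b\<in>Basis. (v \<bullet> b) *\<^sub>R frechet_derivative \<psi> (at (x - a)) b)"
    by (simp add: divergence_def mult.commute)
  also have "\<dots> = frechet_derivative \<psi> (at (x - a)) (\<Sum>b\<in>Basis. (v \<bullet> b) *\<^sub>R b)"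
    using has_derivative_linear[OF Cc_infinity_has_derivative[OF \<psi>]]
    by (simp add: linear_sum linear_scale)
  also have "\<dots> = frechet_derivative \<psi> (at (x - a)) v"
    by (simp add: euclidean_representation)
  finally show "divergence \<phi> x = frechet_derivative \<psi> (at (x - a)) v" .
qed

text \<open>Since f is merely integrable, the shift is carried by \<psi>. Its difference quotients
  are bounded by the maximum of its directional derivative, so differentiation under the integral is
  dominated convergence.\<close>

lemma translated_pairing_has_derivative:
  fixes \<psi> :: "'a::euclidean_space \<Rightarrow> real"
  assumes \<psi>: "\<psi> \<in> Cc_infinity W" and f: "integrable lborel f"
  shows "((\<lambda>t. LINT x|lborel. f x * \<psi> (x - t *\<^sub>R h)) has_field_derivative
    (LINT x|lborel. f x * - frechet_derivative \<psi> (at (x - t *\<^sub>R h)) h)) (at t)"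
proof -
  have deriv: "((\<lambda>t. \<psi> (x - t *\<^sub>R h)) has_field_derivative - frechet_derivative \<psi> (at (x - t *\<^sub>R h)) h) (at t)" for x t
  proof -
    have "((\<lambda>t. x - t *\<^sub>R h) has_derivative (\<lambda>s. - (s *\<^sub>R h))) (at t)"
      by (auto intro!: derivative_eq_intros)
    from has_derivative_compose[OF this Cc_infinity_has_derivative[OF \<psi>]]
    have "((\<lambda>t. \<psi> (x - t *\<^sub>R h)) has_derivative
        (\<lambda>s. frechet_derivative \<psi> (at (x - t *\<^sub>R h)) (- (s *\<^sub>R h)))) (at t)" .
    moreover have "(\<lambda>s. frechet_derivative \<psi> (at (x - t *\<^sub>R h)) (- (s *\<^sub>R h))) =
        (*) (- frechet_derivative \<psi> (at (x - t *\<^sub>R h)) h)"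
      using has_derivative_linear[OF Cc_infinity_has_derivative[OF \<psi>]]
      by (intro ext) (simp add: linear_neg linear_scale)
    ultimately show ?thesis
      by (simp only: has_field_derivative_def)
  qed
  obtain B where B: "0 \<le> B" "\<And>x. norm (frechet_derivative \<psi> (at x) h) \<le> B"
    using Cc_infinity_derivative_bounded[OF \<psi>] by metis
  obtain B' where B': "0 \<le> B'" "\<And>x. norm (\<psi> x) \<le> B'"
    using Cc_infinity_bounded[OF \<psi>] by metis
  have [measurable]: "\<psi> \<in> borel_measurable borel"
    using Cc_infinity_continuous[OF \<psi>] by (rule borel_measurable_continuous_onI)
  have [measurable]: "(\<lambda>x. frechet_derivative \<psi> (at x) h) \<in> borel_measurable borel"
    using Cc_infinity_derivative_continuous[OF \<psi>] by (rule borel_measurable_continuous_onI)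
  have [measurable]: "f \<in> borel_measurable borel" using f by auto
  have int: "integrable lborel (\<lambda>x. f x * \<psi> (x - s *\<^sub>R h))" for s
    using B' by (intro integrable_mult_bounded[OF f, where B=B']) auto
  define D where "D s x = (\<psi> (x - (t + s) *\<^sub>R h) - \<psi> (x - t *\<^sub>R h)) / s" for s x
  \<comment> \<open>By the mean value theorem this bound does not depend on s. At s = 0 the quotient
    is 0, by the convention for division by zero.\<close>
  have bound: "\<bar>D s x\<bar> \<le> B" for s x
  proof (cases "s = 0")
    case False
    have "norm (\<psi> (x - (t + s) *\<^sub>R h) - \<psi> (x - t *\<^sub>R h)) \<le> B * norm (t + s - t)"
      by (rule field_differentiable_bound[of UNIV, OF _ deriv]) (use B(2) in auto)
    then show ?thesis using False by (simp add: D_def field_simps)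
  qed (use B(1) in \<open>simp add: D_def\<close>)
  have "((\<lambda>s. LINT x|lborel. f x * D s x) \<longlongrightarrow> (LINT x|lborel. f x * - frechet_derivative \<psi> (at (x - t *\<^sub>R h)) h)) (at 0)"
    unfolding tendsto_at_iff_sequentially comp_def
  proof (intro allI impI)
    fix X :: "nat \<Rightarrow> real" assume X: "\<forall>i. X i \<in> UNIV - {0}" "X \<longlonglongrightarrow> 0"
    show "(\<lambda>n. LINT x|lborel. f x * D (X n) x) \<longlonglongrightarrow> (LINT x|lborel. f x * - frechet_derivative \<psi> (at (x - t *\<^sub>R h)) h)"
    proof (rule integral_dominated_convergence[of _ _ _ "\<lambda>x. B * \<bar>f x\<bar>"])
      show "AE x in lborel. (\<lambda>n. f x * D (X n) x) \<longlonglongrightarrow> f x * - frechet_derivative \<psi> (at (x - t *\<^sub>R h)) h"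
      proof (intro AE_I2 tendsto_mult tendsto_const)
        fix x
        from deriv[of x t] have "((\<lambda>s. D s x) \<longlongrightarrow> - frechet_derivative \<psi> (at (x - t *\<^sub>R h)) h) (at 0)"
          by (simp add: DERIV_def D_def)
        then show "(\<lambda>n. D (X n) x) \<longlonglongrightarrow> - frechet_derivative \<psi> (at (x - t *\<^sub>R h)) h"
          using X unfolding tendsto_at_iff_sequentially comp_def by blast
      qed
      show "AE x in lborel. norm (f x * D (X n) x) \<le> B * \<bar>f x\<bar>" for n
        using mult_left_mono[OF bound, of "\<bar>f x\<bar>" for x] by (auto simp: abs_mult mult.commute)
    qed (use f in \<open>auto simp: D_def\<close>)
  qed
  then show ?thesis
    unfolding DERIV_def
  proof (rule Lim_transform_eventually)
    have "(LINT x|lborel. f x * D s x) =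
        ((LINT x|lborel. f x * \<psi> (x - (t + s) *\<^sub>R h)) - (LINT x|lborel. f x * \<psi> (x - t *\<^sub>R h))) / s" for s
      unfolding Bochner_Integration.integral_diff[OF int int, symmetric] D_def
      by (simp add: right_diff_distrib flip: integral_divide_zero)
    then show "\<forall>\<^sub>F s in at 0. (LINT x|lborel. f x * D s x) =
        ((LINT x|lborel. f x * \<psi> (x - (t + s) *\<^sub>R h)) - (LINT x|lborel. f x * \<psi> (x - t *\<^sub>R h))) / s"
      by simp
  qed
qed

text \<open>The pairing of f(x + h) - f(x) with \<psi> is G 1 - G 0, hence G' t for some t strictly
  between 0 and 1. This is norm h times the pairing of f with the divergence of a field of norm at
  most 1 supported in W + t h, which lies in \<Omega>. Duality then turns the bound for every \<psi>
  into one for the L^1 norm on W, without smoothing f.\<close>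

lemma translation_estimate:
  fixes f :: "'a::euclidean_space \<Rightarrow> real"
  assumes f: "f \<in> BV_class \<Omega> M V" and "open W"
    and W: "\<And>x t. x \<in> W \<Longrightarrow> 0 \<le> t \<Longrightarrow> t \<le> 1 \<Longrightarrow> x + t *\<^sub>R h \<in> \<Omega>"
  shows "(LINT x|lborel. indicator W x * \<bar>f (x + h) - f x\<bar>) \<le> norm h * V"
proof (cases "h = 0")
  case False
  have int: "integrable lborel f" and [measurable]: "f \<in> borel_measurable borel"
    using f by (auto simp: BV_class_def)
  have int_h: "integrable lborel (\<lambda>x. f (x + h))"
    using int by (simp add: lborel_integrable_translate_iff)
  show ?thesis
  proof (rule L1_norm_le_by_test_functions[OF \<open>open W\<close>])
    show "integrable lborel (\<lambda>x. f (x + h) - f x)"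
      using int int_h by simp
    fix \<psi> :: "'a \<Rightarrow> real" assume \<psi>: "\<psi> \<in> Cc_infinity W" "\<And>x. \<bar>\<psi> x\<bar> \<le> 1"
    have [measurable]: "\<psi> \<in> borel_measurable borel"
      using Cc_infinity_continuous[OF \<psi>(1)] by (rule borel_measurable_continuous_onI)
    define G where "G t = (LINT x|lborel. f x * \<psi> (x - t *\<^sub>R h))" for t
    define G' where "G' t = (LINT x|lborel. f x * - frechet_derivative \<psi> (at (x - t *\<^sub>R h)) h)" for t
    have "(LINT x|lborel. (f (x + h) - f x) * \<psi> x) = (LINT x|lborel. f (x + h) * \<psi> x) - (LINT x|lborel. f x * \<psi> x)"
      unfolding left_diff_distrib
      by (intro Bochner_Integration.integral_diff integrable_mult_bounded[where B=1] int int_h) (use \<psi>(2) in auto)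
    also have "(LINT x|lborel. f (x + h) * \<psi> x) = (LINT x|lborel. f x * \<psi> (x - h))"
      using lborel_integral_translate[of "\<lambda>x. f x * \<psi> (x - h)" h] by simp
    finally have eq: "(LINT x|lborel. (f (x + h) - f x) * \<psi> x) = G 1 - G 0"
      by (simp add: G_def)
    have "(G has_field_derivative G' t) (at t)" for t
      unfolding G_def[abs_def] G'_def by (rule translated_pairing_has_derivative[OF \<psi>(1) int])
    then obtain t where t: "0 < t" "t < 1" "G 1 - G 0 = (1 - 0) * G' t"
      using MVT2[of 0 1 G G'] by auto
    \<comment> \<open>The normalised direction gives norm at most 1 and leaves the factor norm h
      outside; the sign cancels the one from differentiating \<psi>(x - t h) in t.\<close>
    define \<phi> where "\<phi> = (\<lambda>x. \<psi> (x - t *\<^sub>R h) *\<^sub>R (- (1 / norm h) *\<^sub>R h))"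
    have \<phi>: "\<phi> \<in> Cc_infinity \<Omega>"
        "\<And>x. divergence \<phi> x = frechet_derivative \<psi> (at (x - t *\<^sub>R h)) (- (1 / norm h) *\<^sub>R h)"
      unfolding \<phi>_def by (rule Cc_infinity_translated_field[OF \<psi>(1), where \<Omega> = \<Omega>]; use W t in simp)+
    have "frechet_derivative \<psi> (at (x - t *\<^sub>R h)) h = - (norm h * divergence \<phi> x)" for x
      using has_derivative_linear[OF Cc_infinity_has_derivative[OF \<psi>(1)]] False
      unfolding \<phi>(2) by (simp add: linear_scale del: scaleR_minus_left)
    then have "G' t = norm h * (LINT x|lborel. f x * divergence \<phi> x)"
      by (simp add: G'_def mult.left_commute)
    also have "\<dots> \<le> norm h * V"
    proof (rule mult_left_mono)
      have "norm (\<phi> x) \<le> 1" for x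
        using \<psi>(2) False by (simp add: \<phi>_def)
      then show "(LINT x|lborel. f x * divergence \<phi> x) \<le> V"
        using f \<phi>(1) by (auto simp: BV_class_def)
    qed simp
    finally show "(LINT x|lborel. (f (x + h) - f x) * \<psi> x) \<le> norm h * V"
      using eq t(3) by simp
  qed
qed simp

subsection \<open>No concentration at the boundary\<close>

lemma BV_class_nonneg:
  assumes "f \<in> BV_class \<Omega> M V"
  shows "0 \<le> M" "0 \<le> V"
proof -
  have "0 \<le> (LINT x|lborel. \<bar>f x\<bar>)" by simp
  also have "\<dots> \<le> M" using assms by (simp add: BV_class_def)
  finally show "0 \<le> M" .
  have "(\<lambda>_. 0) \<in> Cc_infinity \<Omega>"
    by (auto simp: Cc_infinity_def C_k_const)
  moreover have "divergence (\<lambda>_. 0) x = 0" for x :: 'a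
    by (simp add: divergence_def)
  ultimately show "0 \<le> V"
    using assms by (fastforce simp: BV_class_def)
qed

lemma integrable_indicator_mult_abs:
  fixes f :: "'a \<Rightarrow> real"
  assumes "integrable M f" "S \<in> sets M"
  shows "integrable M (\<lambda>x. indicator S x * \<bar>f x\<bar>)"
  using integrable_mult_indicator[OF assms(2) integrable_abs[OF assms(1)]] by simp

text \<open>The translates of the strip \<open>S\<close> by \<open>j a e\<close>, \<open>j < m\<close>, are disjoint, so on average over \<open>j\<close>
  they carry mass at most \<open>M/m\<close>; each differs from the mass of \<open>S\<close> by at most \<open>m a V\<close>.\<close>

lemma boundary_strip_estimate:
  fixes \<Omega> :: "'a::euclidean_space set"
  assumes f: "f \<in> BV_class \<Omega> M V" and [measurable]: "S \<in> sets borel" and "open S"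
    and \<tau>: "\<And>y t. \<tau> (y + t *\<^sub>R e) = \<tau> y + t"
    and S: "\<And>y. y \<in> S \<Longrightarrow> 0 < \<tau> y \<and> \<tau> y < a"
    and shift: "\<And>y t. y \<in> S \<Longrightarrow> 0 \<le> t \<Longrightarrow> t \<le> real m * a \<Longrightarrow> y + t *\<^sub>R e \<in> \<Omega>"
    and "norm e = 1" "0 < a" "0 < m"
  shows "(LINT x|lborel. indicator S x * \<bar>f x\<bar>) \<le> M / m + m * a * V"
proof -
  have int: "integrable lborel f" and [measurable]: "f \<in> borel_measurable borel"
    using f by (auto simp: BV_class_def)
  let ?I = "LINT x|lborel. indicator S x * \<bar>f x\<bar>"
  let ?J = "\<lambda>j. LINT x|lborel. indicator S (x - (real j * a) *\<^sub>R e) * \<bar>f x\<bar>"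
  have int_h: "integrable lborel (\<lambda>x. f (x + h))" for h
    using int by (simp add: lborel_integrable_translate_iff)
  have int_S: "integrable lborel (\<lambda>x. indicator S (x - h) * \<bar>f x\<bar>)" for h
    using integrable_mult_bounded[of lborel "\<lambda>x. \<bar>f x\<bar>" "\<lambda>x. indicator S (x - h)" 1] int
    by (simp add: mult.commute)
  have step: "?I \<le> ?J j + m * a * V" if "j \<le> m" for j
  proof -
    define h where "h = (real j * a) *\<^sub>R e"
    have "?I \<le> (LINT x|lborel. indicator S x * \<bar>f (x + h)\<bar> + indicator S x * \<bar>f (x + h) - f x\<bar>)"
      using int int_h
      by (intro integral_mono integrable_indicator_mult_abs Bochner_Integration.integrable_add
          Bochner_Integration.integrable_diff) (auto simp: indicator_def)
    also have "\<dots> = (LINT x|lborel. indicator S x * \<bar>f (x + h)\<bar>) + (LINT x|lborel. indicator S x * \<bar>f (x + h) - f x\<bar>)"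
      using int int_h
      by (intro Bochner_Integration.integral_add integrable_indicator_mult_abs
          Bochner_Integration.integrable_diff) auto
    also have "(LINT x|lborel. indicator S x * \<bar>f (x + h)\<bar>) = ?J j"
      using lborel_integral_translate[of "\<lambda>x. indicator S (x - h) * \<bar>f x\<bar>" h] by (simp add: h_def)
    also have "(LINT x|lborel. indicator S x * \<bar>f (x + h) - f x\<bar>) \<le> norm h * V"
    proof (rule translation_estimate[OF f \<open>open S\<close>])
      fix x t assume "x \<in> S" "0 \<le> t" "t \<le> (1::real)"
      moreover have "t * (real j * a) \<le> real m * a"
        using \<open>0 \<le> t\<close> \<open>t \<le> 1\<close> \<open>j \<le> m\<close> \<open>0 < a\<close>
        by (intro order_trans[OF mult_left_le_one_le mult_right_mono]) auto
      ultimately show "x + t *\<^sub>R h \<in> \<Omega>"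
        using shift[of x "t * (real j * a)"] \<open>0 < a\<close> by (simp add: h_def)
    qed
    also have "norm h * V \<le> m * a * V"
      using \<open>norm e = 1\<close> \<open>0 < a\<close> \<open>j \<le> m\<close> BV_class_nonneg[OF f]
      by (auto simp: h_def abs_mult intro!: mult_right_mono)
    finally show ?thesis by simp
  qed
  have disj: "(\<Sum>j<m. indicator S (x - (real j * a) *\<^sub>R e)) \<le> (1::real)" for x
  proof -
    \<comment> \<open>Disjointness of the translates: \<tau> takes values in (0, a) on S and in (j
      a, (j + 1) a) on the j-th translate, so x determines j as the floor of \<tau> x / a.\<close>
    have "indicator S (x - (real j * a) *\<^sub>R e) \<le> (if j = nat \<lfloor>\<tau> x / a\<rfloor> then 1 else 0::real)" for j
    proof (cases "x - (real j * a) *\<^sub>R e \<in> S")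
      case True
      have "\<tau> x = \<tau> (x - (real j * a) *\<^sub>R e) + real j * a"
        using \<tau>[of "x - (real j * a) *\<^sub>R e" "real j * a"] by simp
      with S[OF True] have "real j * a < \<tau> x" "\<tau> x < (real j + 1) * a"
        by (auto simp: algebra_simps)
      then have "\<lfloor>\<tau> x / a\<rfloor> = int j"
        using \<open>0 < a\<close> by (simp add: floor_unique field_simps)
      then show ?thesis by (simp add: indicator_def)
    qed simp
    then have "(\<Sum>j<m. indicator S (x - (real j * a) *\<^sub>R e)) \<le> (\<Sum>j<m. if j = nat \<lfloor>\<tau> x / a\<rfloor> then 1 else 0::real)"
      by (rule sum_mono)
    also have "\<dots> \<le> 1" by simp
    finally show ?thesis .
  qed
  define N where "N x = (\<Sum>j<m. indicator S (x - (real j * a) *\<^sub>R e) :: real)" for x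
  have N_int: "integrable lborel (\<lambda>x. N x * \<bar>f x\<bar>)"
    unfolding N_def sum_distrib_right by (intro Bochner_Integration.integrable_sum int_S)
  have "m * ?I \<le> (\<Sum>j<m. ?J j + m * a * V)"
    using sum_mono[of "{..<m}" "\<lambda>_. ?I" "\<lambda>j. ?J j + m * a * V"] step by simp
  also have "\<dots> = (\<Sum>j<m. ?J j) + m * (m * a * V)"
    by (simp only: sum.distrib) simp
  also have "(\<Sum>j<m. ?J j) = (LINT x|lborel. N x * \<bar>f x\<bar>)"
    unfolding N_def sum_distrib_right by (rule Bochner_Integration.integral_sum[symmetric]) (rule int_S)
  also have "\<dots> \<le> (LINT x|lborel. \<bar>f x\<bar>)"
    using N_int integrable_abs[OF int]
  proof (rule integral_mono)
    show "N x * \<bar>f x\<bar> \<le> \<bar>f x\<bar>" for x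
      using mult_right_mono[OF disj, of "\<bar>f x\<bar>" x] by (simp add: N_def)
  qed
  also have "\<dots> \<le> M" using f by (simp add: BV_class_def)
  finally show ?thesis
    using \<open>0 < m\<close> by (simp add: field_simps)
qed

text \<open>The radius \<rho> must not depend on \<epsilon>: the finite cover of the boundary is
  chosen first, and the tolerance per ball is then \<epsilon> divided by a number depending on that
  cover. Only the thickness of U shrinks with \<epsilon>.\<close>

lemma no_concentration_near_boundary_point:
  fixes \<Omega> :: "'a::euclidean_space set"
  assumes "open \<Omega>" "Lipschitz_boundary \<Omega>" "x0 \<in> frontier \<Omega>"
  obtains \<rho> where "0 < \<rho>"
    "\<And>\<epsilon>. 0 < \<epsilon> \<Longrightarrow> \<exists>U. open U \<and> frontier \<Omega> \<inter> ball x0 \<rho> \<subseteq> U \<and>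
      (\<forall>f\<in>BV_class \<Omega> M V. (LINT x|lborel. indicator U x * \<bar>f x\<bar>) \<le> \<epsilon>)"
proof -
  from bspec[OF assms(2)[unfolded Lipschitz_boundary_def] assms(3)]
  obtain r e L g where r: "0 < r" "norm e = 1" "L-lipschitz_on {z. z \<bullet> e = 0} (g :: 'a \<Rightarrow> real)"
    "\<Omega> \<inter> ball x0 r = {y \<in> ball x0 r. y \<bullet> e > g (y - (y \<bullet> e) *\<^sub>R e)}"
    by blast
  \<comment> \<open>The height above the graph in direction e. Since g sees only the component
    orthogonal to e, a shift by t e raises it by exactly t.\<close>
  define \<tau> where "\<tau> y = y \<bullet> e - g (y - (y \<bullet> e) *\<^sub>R e)" for y
  have ee: "e \<bullet> e = 1" using r(2) by (simp add: dot_square_norm)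
  have \<tau>_shift: "\<tau> (y + t *\<^sub>R e) = \<tau> y + t" for y t
    by (simp add: \<tau>_def inner_add_left ee algebra_simps)
  have \<Omega>_iff: "y \<in> \<Omega> \<longleftrightarrow> 0 < \<tau> y" if "y \<in> ball x0 r" for y
    using that eqset_imp_iff[OF r(4), of y] by (simp add: \<tau>_def)
  have "continuous_on UNIV (\<lambda>y. g (y - (y \<bullet> e) *\<^sub>R e))"
    by (rule continuous_on_compose2[OF lipschitz_on_continuous_on[OF r(3)]])
       (auto intro!: continuous_intros simp: inner_diff_left ee)
  then have \<tau>_cont: "continuous_on UNIV \<tau>"
    unfolding \<tau>_def[abs_def] by (intro continuous_intros)
  show thesis
  proof
    show "0 < r / 2" using r by simp
    fix \<epsilon> :: real assume "0 < \<epsilon>"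
    \<comment> \<open>First m makes M/m small; then a makes m a V small and m a at most r / 4, so
      that translates starting in the half ball stay in the chart. Absolute values stand in for M
      and V because their nonnegativity is known only once a member of the class is given.\<close>
    obtain m :: nat where m: "0 < m" "\<bar>M\<bar> / m < \<epsilon> / 2"
    proof -
      obtain m :: nat where "2 * \<bar>M\<bar> / \<epsilon> < m" using reals_Archimedean2 by blast
      moreover from this have "0 < m" using \<open>0 < \<epsilon>\<close>
        by (smt (verit, best) divide_nonneg_pos of_nat_0_less_iff)
      ultimately show ?thesis using \<open>0 < \<epsilon>\<close> by (intro that[of m]) (auto simp: field_simps)
    qed
    define a where "a = min (r / (4 * m)) (\<epsilon> / (2 * m * (\<bar>V\<bar> + 1)))"
    have "0 < a" using m(1) \<open>0 < \<epsilon>\<close> r(1) by (auto simp: a_def)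
    have ma: "m * a < r / 2"
    proof -
      have "m * a \<le> m * (r / (4 * m))" unfolding a_def by (intro mult_left_mono) auto
      also have "\<dots> < r / 2" using m(1) r(1) by simp
      finally show ?thesis .
    qed
    have maV: "m * a * \<bar>V\<bar> \<le> \<epsilon> / 2"
    proof -
      have "m * a * \<bar>V\<bar> \<le> m * a * (\<bar>V\<bar> + 1)" using \<open>0 < a\<close> by (intro mult_left_mono) auto
      also have "\<dots> \<le> m * (\<epsilon> / (2 * m * (\<bar>V\<bar> + 1))) * (\<bar>V\<bar> + 1)"
        unfolding a_def by (intro mult_right_mono mult_left_mono) auto
      also have "\<dots> = \<epsilon> / 2" using m(1) by (simp add: field_simps add_nonneg_eq_0_iff)
      finally show ?thesis .
    qed
    \<comment> \<open>U has no lower bound on \<tau>, so it is an open neighbourhood of the boundary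
      portion, where \<tau> is at most 0. Every f of the class vanishes at the points of U outside
      \<Omega>, so its mass on U is its mass on the strip S.\<close>
    define U where "U = ball x0 (r / 2) \<inter> {y. \<tau> y < a}"
    define S where "S = U \<inter> {y. 0 < \<tau> y}"
    have [simp]: "open U" "open S"
      unfolding U_def S_def using \<tau>_cont by (auto intro!: open_Int open_Collect_less continuous_intros)
    have sub: "y \<in> ball x0 r" if "y \<in> ball x0 (r / 2)" for y
      using that r(1) by auto
    have "frontier \<Omega> \<inter> ball x0 (r / 2) \<subseteq> U"
    proof
      fix y assume "y \<in> frontier \<Omega> \<inter> ball x0 (r / 2)"
      moreover from this have "y \<notin> \<Omega>" using \<open>open \<Omega>\<close> by (auto simp: frontier_def interior_open)
      ultimately show "y \<in> U" using \<Omega>_iff[OF sub] \<open>0 < a\<close> by (auto simp: U_def)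
    qed
    moreover have "(LINT x|lborel. indicator U x * \<bar>f x\<bar>) \<le> \<epsilon>" if f: "f \<in> BV_class \<Omega> M V" for f
    proof -
      have "indicator U x * \<bar>f x\<bar> = indicator S x * \<bar>f x\<bar>" for x
        using f \<Omega>_iff[OF sub, of x] by (auto simp: S_def U_def indicator_def BV_class_def)
      then have "(LINT x|lborel. indicator U x * \<bar>f x\<bar>) = (LINT x|lborel. indicator S x * \<bar>f x\<bar>)"
        by (rule Bochner_Integration.integral_cong[OF refl])
      also have "\<dots> \<le> M / m + m * a * V"
      proof (rule boundary_strip_estimate[OF f borel_open[OF \<open>open S\<close>] \<open>open S\<close> \<tau>_shift _ _ r(2) \<open>0 < a\<close> m(1)])
        fix y t assume y: "y \<in> S" "0 \<le> t" "t \<le> real m * a"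
        have t: "dist y (y + t *\<^sub>R e) = t" using r(2) y(2) by (simp add: dist_norm)
        have "dist x0 (y + t *\<^sub>R e) \<le> dist x0 y + dist y (y + t *\<^sub>R e)" by (rule dist_triangle)
        also have "\<dots> < r" using y ma unfolding t by (auto simp: S_def U_def)
        finally have "y + t *\<^sub>R e \<in> ball x0 r" by simp
        then show "y + t *\<^sub>R e \<in> \<Omega>"
          using y by (simp add: \<Omega>_iff \<tau>_shift S_def)
      qed (auto simp: S_def U_def)
      also have "\<dots> \<le> \<epsilon>"
        using m(2) maV unfolding abs_of_nonneg[OF BV_class_nonneg(1)[OF f]]
          abs_of_nonneg[OF BV_class_nonneg(2)[OF f]] by linarith
      finally show ?thesis .
    qed
    ultimately show "\<exists>U. open U \<and> frontier \<Omega> \<inter> ball x0 (r / 2) \<subseteq> U \<and>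
      (\<forall>f\<in>BV_class \<Omega> M V. (LINT x|lborel. indicator U x * \<bar>f x\<bar>) \<le> \<epsilon>)"
      using \<open>open U\<close> by blast
  qed
qed

text \<open>Compactness of the boundary turns the local statement into a global one: finitely many
  neighbourhoods cover the boundary, and their masses add up to at most \<epsilon>.\<close>

lemma uniform_tightness:
  fixes \<Omega> :: "'a::euclidean_space set"
  assumes "open \<Omega>" "bounded \<Omega>" "Lipschitz_boundary \<Omega>" "0 < \<epsilon>"
  obtains K where "compact K" "K \<subseteq> \<Omega>"
    "\<And>f. f \<in> BV_class \<Omega> M V \<Longrightarrow> (LINT x|lborel. indicator (- K) x * \<bar>f x\<bar>) \<le> \<epsilon>"
proof -
  have "\<exists>\<rho>>0. \<forall>\<epsilon>>0. \<exists>U. open U \<and> frontier \<Omega> \<inter> ball x \<rho> \<subseteq> U \<and>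
      (\<forall>f\<in>BV_class \<Omega> M V. (LINT x|lborel. indicator U x * \<bar>f x\<bar>) \<le> \<epsilon>)" if "x \<in> frontier \<Omega>" for x
    by (rule no_concentration_near_boundary_point[OF assms(1,3) that]) blast
  then obtain \<rho> where \<rho>: "\<And>x. x \<in> frontier \<Omega> \<Longrightarrow> 0 < \<rho> x"
    "\<And>x \<epsilon>. x \<in> frontier \<Omega> \<Longrightarrow> 0 < \<epsilon> \<Longrightarrow> \<exists>U. open U \<and> frontier \<Omega> \<inter> ball x (\<rho> x) \<subseteq> U \<and>
      (\<forall>f\<in>BV_class \<Omega> M V. (LINT x|lborel. indicator U x * \<bar>f x\<bar>) \<le> \<epsilon>)"
    by metis
  have cpt: "compact (frontier \<Omega>)"
    using \<open>bounded \<Omega>\<close> by (rule compact_frontier_bounded)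
  have cover: "frontier \<Omega> \<subseteq> (\<Union>x\<in>frontier \<Omega>. ball x (\<rho> x))"
    using \<rho>(1) by force
  obtain D where D: "D \<subseteq> frontier \<Omega>" "finite D" "frontier \<Omega> \<subseteq> (\<Union>x\<in>D. ball x (\<rho> x))"
    by (rule compactE_image[OF cpt _ cover]) (rule open_ball, rule that)
  define \<delta> where "\<delta> = \<epsilon> / (card D + 1)"
  have "0 < \<delta>" using \<open>0 < \<epsilon>\<close> by (simp add: \<delta>_def add_nonneg_pos)
  then have "\<forall>x\<in>D. \<exists>U. open U \<and> frontier \<Omega> \<inter> ball x (\<rho> x) \<subseteq> U \<and>
      (\<forall>f\<in>BV_class \<Omega> M V. (LINT x|lborel. indicator U x * \<bar>f x\<bar>) \<le> \<delta>)"
    using \<rho>(2) D(1) by blast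
  then obtain U where U: "\<And>x. x \<in> D \<Longrightarrow> open (U x)"
    "\<And>x. x \<in> D \<Longrightarrow> frontier \<Omega> \<inter> ball x (\<rho> x) \<subseteq> U x"
    "\<And>x f. x \<in> D \<Longrightarrow> f \<in> BV_class \<Omega> M V \<Longrightarrow> (LINT y|lborel. indicator (U x) y * \<bar>f y\<bar>) \<le> \<delta>"
    by metis
  \<comment> \<open>Removing a neighbourhood of the boundary from the closure leaves a closed set
    inside \<Omega>. Outside K a function of the class is either 0 or evaluated in one of the U
    x.\<close>
  define K where "K = closure \<Omega> - (\<Union>x\<in>D. U x)"
  have "frontier \<Omega> \<subseteq> (\<Union>x\<in>D. U x)"
    using D(3) U(2) by blast
  then have "K \<subseteq> \<Omega>"
    using \<open>open \<Omega>\<close> by (auto simp: K_def frontier_def interior_open)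
  moreover have "compact K"
    unfolding K_def using \<open>bounded \<Omega>\<close> U(1) by (intro compact_diff) auto
  moreover have "(LINT x|lborel. indicator (- K) x * \<bar>f x\<bar>) \<le> \<epsilon>" if f: "f \<in> BV_class \<Omega> M V" for f
  proof -
    have int: "integrable lborel f" using f by (auto simp: BV_class_def)
    have "K \<in> sets borel" using \<open>compact K\<close> by (simp add: borel_closed compact_imp_closed)
    have int_U: "integrable lborel (\<lambda>y. indicator (U x) y * \<bar>f y\<bar>)" if "x \<in> D" for x
      using int U(1)[OF that] by (intro integrable_indicator_mult_abs) auto
    have "indicator (- K) y * \<bar>f y\<bar> \<le> (\<Sum>x\<in>D. indicator (U x) y * \<bar>f y\<bar>)" for y
    proof (cases "f y = 0 \<or> y \<in> K")
      case False
      then have "y \<in> \<Omega>" using f by (auto simp: BV_class_def)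
      then obtain x where "x \<in> D" "y \<in> U x"
        using False closure_subset[of \<Omega>] by (auto simp: K_def)
      then show ?thesis
        using member_le_sum[of x D "\<lambda>x. indicator (U x) y * \<bar>f y\<bar>"] \<open>finite D\<close> by (simp add: indicator_def)
    qed (auto intro!: sum_nonneg)
    then have "(LINT y|lborel. indicator (- K) y * \<bar>f y\<bar>) \<le> (LINT y|lborel. (\<Sum>x\<in>D. indicator (U x) y * \<bar>f y\<bar>))"
      using int int_U \<open>K \<in> sets borel\<close>
      by (intro integral_mono integrable_indicator_mult_abs Bochner_Integration.integrable_sum) (auto intro!: borel_open U(1))
    also have "\<dots> = (\<Sum>x\<in>D. (LINT y|lborel. indicator (U x) y * \<bar>f y\<bar>))"
      using int_U by (rule Bochner_Integration.integral_sum)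
    also have "\<dots> \<le> card D * \<delta>"
      using U(3) f by (intro sum_bounded_above) auto
    also have "\<dots> \<le> \<epsilon>"
      using \<open>0 < \<epsilon>\<close> by (simp add: \<delta>_def field_simps)
    finally show ?thesis .
  qed
  ultimately show thesis using that[of K] by blast
qed

subsection \<open>Averaging with a Lipschitz kernel\<close>

text \<open>A cone of radius and height s. Its slope is 1 whatever s is, and Lipschitz regularity is
  enough because the averages need only be equicontinuous.\<close>

definition tent :: "real \<Rightarrow> 'a::euclidean_space \<Rightarrow> real" where
  "tent s z = max 0 (s - norm z)"

text \<open>The kernel is not normalised: averages approximate \<open>c f\<close>, where \<open>c\<close> is the integral of the kernel.\<close>

definition average :: "real \<Rightarrow> ('a::euclidean_space \<Rightarrow> real) \<Rightarrow> 'a \<Rightarrow> real" where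
  "average s f x = (LINT z|lborel. tent s z * f (x + z))"

lemma tent_nonneg: "0 \<le> tent s z"
  by (simp add: tent_def)

lemma abs_tent [simp]: "\<bar>tent s z\<bar> = tent s z"
  by (simp add: tent_nonneg)

lemma tent_eq_0: "s \<le> norm z \<Longrightarrow> tent s z = 0"
  by (simp add: tent_def)

lemma tent_le: "0 \<le> s \<Longrightarrow> tent s z \<le> s"
  by (simp add: tent_def)

lemma tent_lipschitz: "\<bar>tent s z - tent s w\<bar> \<le> norm (z - w)"
  using norm_triangle_ineq3[of z w] by (auto simp: tent_def max_def)

lemma continuous_on_tent: "continuous_on UNIV (tent s)"
  unfolding tent_def[abs_def] by (intro continuous_intros)

lemma tent_measurable [measurable]: "tent s \<in> borel_measurable borel"
  using continuous_on_tent by (rule borel_measurable_continuous_onI)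

lemma tent_integrable: "integrable lborel (tent s :: 'a::euclidean_space \<Rightarrow> real)"
proof -
  have "integrable lborel (\<lambda>x::'a. indicator (cball 0 s) x *\<^sub>R tent s x)"
    by (intro borel_integrable_compact) (auto intro: continuous_on_subset[OF continuous_on_tent])
  moreover have "(\<lambda>x::'a. indicator (cball 0 s) x *\<^sub>R tent s x) = tent s"
    by (intro ext) (auto simp: indicator_def tent_eq_0)
  ultimately show ?thesis by simp
qed

lemma tent_integral_pos:
  assumes "0 < s"
  shows "0 < (LINT z|lborel. tent s (z :: 'a::euclidean_space))"
proof -
  have "0 < s / 2 * measure lborel (ball (0::'a) (s / 2))"
    using assms by (simp add: content_ball_pos)
  also have "\<dots> = (LINT z|lborel. s / 2 * indicator (ball (0::'a) (s / 2)) z)"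
    by simp
  also have "\<dots> \<le> (LINT z|lborel. tent s (z :: 'a))"
  proof (rule integral_mono)
    show "integrable lborel (\<lambda>z::'a. s / 2 * indicator (ball 0 (s / 2)) z)"
      by (intro integrable_mult_right integrable_real_indicator emeasure_bounded_finite) auto
    show "s / 2 * indicator (ball 0 (s / 2)) z \<le> tent s z" for z :: 'a
      using tent_nonneg[of s z] by (auto simp: indicator_def tent_def max_def)
  qed (rule tent_integrable)
  finally show ?thesis .
qed

lemma average_eq:
  assumes "f \<in> borel_measurable borel"
  shows "average s f x = (LINT y|lborel. f y * tent s (y - x))"
  using lborel_integral_translate[of "\<lambda>y. f y * tent s (y - x)" x] assms
  by (simp add: average_def mult.commute add.commute)

text \<open>After the change of variables in \<open>average_eq\<close> the point x occurs in the
  kernel only, so the average inherits the size and the Lipschitz constant of \<open>tent\<close>,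
  multiplied by the L^1 norm of f. Both bounds are therefore uniform over the sequence.\<close>

lemma
  fixes f :: "'a::euclidean_space \<Rightarrow> real"
  assumes f: "integrable lborel f" and "(LINT x|lborel. \<bar>f x\<bar>) \<le> M" and "0 \<le> s"
  shows average_bound: "\<bar>average s f x\<bar> \<le> s * M"
    and average_lipschitz: "\<bar>average s f x - average s f y\<bar> \<le> dist x y * M"
proof -
  have [measurable]: "f \<in> borel_measurable borel" using f by auto
  have int: "integrable lborel (\<lambda>y. f y * tent s (y - x))" for x
    using tent_le[OF \<open>0 \<le> s\<close>] tent_nonneg by (intro integrable_mult_bounded[OF f, where B = s]) auto
  have "\<bar>LINT y|lborel. f y * tent s (y - x)\<bar> \<le> (LINT y|lborel. \<bar>f y * tent s (y - x)\<bar>)"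
    by (rule integral_abs_bound)
  also have "\<dots> \<le> (LINT y|lborel. s * \<bar>f y\<bar>)"
  proof (rule integral_mono)
    show "\<bar>f y * tent s (y - x)\<bar> \<le> s * \<bar>f y\<bar>" for y
      using mult_right_mono[OF tent_le[OF \<open>0 \<le> s\<close>, of "y - x"], of "\<bar>f y\<bar>"]
      by (simp add: abs_mult mult.commute)
  qed (use f integrable_abs[OF int] in auto)
  also have "\<dots> \<le> s * M" using assms by (simp add: mult_left_mono)
  finally show "\<bar>average s f x\<bar> \<le> s * M" by (simp add: average_eq)
  have "average s f x - average s f y = (LINT z|lborel. f z * (tent s (z - x) - tent s (z - y)))"
    using int by (simp add: average_eq right_diff_distrib)
  also have "\<bar>\<dots>\<bar> \<le> (LINT z|lborel. \<bar>f z * (tent s (z - x) - tent s (z - y))\<bar>)"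
    by (rule integral_abs_bound)
  also have "\<dots> \<le> (LINT z|lborel. dist x y * \<bar>f z\<bar>)"
  proof (rule integral_mono)
    show "integrable lborel (\<lambda>z. \<bar>f z * (tent s (z - x) - tent s (z - y))\<bar>)"
      using int[of x] int[of y] by (simp add: right_diff_distrib)
    have "\<bar>tent s (z - x) - tent s (z - y)\<bar> \<le> dist x y" for z
      using tent_lipschitz[of s "z - x" "z - y"] by (simp add: dist_norm norm_minus_commute)
    then show "\<bar>f z * (tent s (z - x) - tent s (z - y))\<bar> \<le> dist x y * \<bar>f z\<bar>" for z
      using mult_right_mono[of "\<bar>tent s (z - x) - tent s (z - y)\<bar>" "dist x y" "\<bar>f z\<bar>"]
      by (simp add: abs_mult mult.commute)
  qed (use f in auto)
  also have "\<dots> \<le> dist x y * M" using assms by (simp add: mult_left_mono)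
  finally show "\<bar>average s f x - average s f y\<bar> \<le> dist x y * M" .
qed

lemma average_measurable [measurable]:
  fixes f :: "'a::euclidean_space \<Rightarrow> real"
  assumes [measurable]: "f \<in> borel_measurable borel"
  shows "average s f \<in> borel_measurable borel"
  unfolding average_def[abs_def] by measurable

text \<open>The difference c f(x) - average is the kernel-weighted mean of f(x) - f(x + z).
  Exchanging the integrals by Tonelli leaves, for each z, the translation estimate on W with shift
  z. Nonnegative integrals yield integrability and the bound at once.\<close>

lemma average_approximation:
  fixes f :: "'a::euclidean_space \<Rightarrow> real"
  assumes f: "f \<in> BV_class \<Omega> M V" and "open W" "0 < s"
    and W: "\<And>x. x \<in> W \<Longrightarrow> ball x s \<subseteq> \<Omega>"
  defines "c \<equiv> LINT z|lborel. tent s (z :: 'a)"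
  shows "integrable lborel (\<lambda>x. indicator W x * \<bar>c * f x - average s f x\<bar>)"
    and "(LINT x|lborel. indicator W x * \<bar>c * f x - average s f x\<bar>) \<le> c * (s * V)"
proof -
  have int: "integrable lborel f" and [measurable]: "f \<in> borel_measurable borel"
    using f by (auto simp: BV_class_def)
  have [measurable]: "W \<in> sets borel" using \<open>open W\<close> by simp
  have V: "0 \<le> V" using BV_class_nonneg[OF f] by simp
  have c: "0 < c" unfolding c_def by (rule tent_integral_pos[OF \<open>0 < s\<close>])
  have tent_int: "integrable lborel (tent s :: 'a \<Rightarrow> real)" by (rule tent_integrable)
  have int_h: "integrable lborel (\<lambda>x. f (x + h))" for h
    using int by (simp add: lborel_integrable_translate_iff)
  have int_k: "integrable lborel (\<lambda>z. tent s z * f (x + z))" for x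
  proof -
    have "integrable lborel (\<lambda>z. f (z + x) * tent s z)"
      by (rule integrable_mult_bounded[OF int_h, where B = s]) (use \<open>0 < s\<close> in \<open>auto intro: tent_le\<close>)
    then show ?thesis by (simp add: mult.commute add.commute)
  qed
  have pointwise: "\<bar>c * f x - average s f x\<bar> \<le> (LINT z|lborel. tent s z * \<bar>f (x + z) - f x\<bar>)"
    and int_pointwise: "integrable lborel (\<lambda>z. tent s z * \<bar>f (x + z) - f x\<bar>)" for x
  proof -
    have int': "integrable lborel (\<lambda>z. tent s z * (f x - f (x + z)))"
      unfolding right_diff_distrib
      by (intro Bochner_Integration.integrable_diff integrable_mult_left tent_int int_k)
    have "c * f x - average s f x = (LINT z|lborel. tent s z * (f x - f (x + z)))"
      using int_k tent_int by (simp add: c_def average_def right_diff_distrib)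
    also have "\<bar>\<dots>\<bar> \<le> (LINT z|lborel. \<bar>tent s z * (f x - f (x + z))\<bar>)"
      by (rule integral_abs_bound)
    also have "\<dots> = (LINT z|lborel. tent s z * \<bar>f (x + z) - f x\<bar>)"
      by (simp add: abs_mult tent_nonneg abs_minus_commute)
    finally show "\<bar>c * f x - average s f x\<bar> \<le> (LINT z|lborel. tent s z * \<bar>f (x + z) - f x\<bar>)" .
    show "integrable lborel (\<lambda>z. tent s z * \<bar>f (x + z) - f x\<bar>)"
      using integrable_abs[OF int'] by (simp add: abs_mult tent_nonneg abs_minus_commute)
  qed
  have "(\<integral>\<^sup>+x. ennreal (indicator W x * \<bar>c * f x - average s f x\<bar>) \<partial>lborel)
      \<le> (\<integral>\<^sup>+x. \<integral>\<^sup>+z. ennreal (indicator W x * (tent s z * \<bar>f (x + z) - f x\<bar>)) \<partial>lborel \<partial>lborel)"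
  proof (rule nn_integral_mono)
    fix x
    have "ennreal (indicator W x * \<bar>c * f x - average s f x\<bar>)
        \<le> ennreal (LINT z|lborel. indicator W x * (tent s z * \<bar>f (x + z) - f x\<bar>))"
      using pointwise by (intro ennreal_leI) (auto simp: indicator_def)
    also have "\<dots> = (\<integral>\<^sup>+z. ennreal (indicator W x * (tent s z * \<bar>f (x + z) - f x\<bar>)) \<partial>lborel)"
      by (intro nn_integral_eq_integral[symmetric] integrable_mult_right int_pointwise AE_I2
          mult_nonneg_nonneg tent_nonneg) auto
    finally show "ennreal (indicator W x * \<bar>c * f x - average s f x\<bar>)
        \<le> (\<integral>\<^sup>+z. ennreal (indicator W x * (tent s z * \<bar>f (x + z) - f x\<bar>)) \<partial>lborel)" .
  qed
  also have "\<dots> = (\<integral>\<^sup>+z. \<integral>\<^sup>+x. ennreal (indicator W x * (tent s z * \<bar>f (x + z) - f x\<bar>)) \<partial>lborel \<partial>lborel)"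
    by (rule lborel_pair.Fubini') measurable
  also have "\<dots> \<le> (\<integral>\<^sup>+z. ennreal (tent s (z::'a) * (s * V)) \<partial>lborel)"
  proof (rule nn_integral_mono)
    fix z :: 'a
    have "(\<integral>\<^sup>+x. ennreal (indicator W x * (tent s z * \<bar>f (x + z) - f x\<bar>)) \<partial>lborel) =
        (\<integral>\<^sup>+x. ennreal (tent s z * (indicator W x * \<bar>f (x + z) - f x\<bar>)) \<partial>lborel)"
      by (simp add: mult.left_commute)
    also have "\<dots> = ennreal (LINT x|lborel. tent s z * (indicator W x * \<bar>f (x + z) - f x\<bar>))"
      using int int_h
      by (intro nn_integral_eq_integral integrable_mult_right integrable_indicator_mult_abs AE_I2
          mult_nonneg_nonneg tent_nonneg Bochner_Integration.integrable_diff) auto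
    \<comment> \<open>For norm z < s the segments from W stay in \<Omega>; for larger z the kernel
      vanishes.\<close>
    also have "\<dots> \<le> ennreal (tent s z * (s * V))"
    proof (cases "norm z < s")
      case True
      have "(LINT x|lborel. indicator W x * \<bar>f (x + z) - f x\<bar>) \<le> norm z * V"
      proof (rule translation_estimate[OF f \<open>open W\<close>])
        fix x t assume "x \<in> W" "0 \<le> t" "t \<le> (1::real)"
        then have "norm (t *\<^sub>R z) < s"
          using True mult_left_le_one_le[of "norm z" t] by auto
        then show "x + t *\<^sub>R z \<in> \<Omega>"
          using W[OF \<open>x \<in> W\<close>] by (auto simp: dist_norm subset_iff)
      qed
      also have "\<dots> \<le> s * V" using True V by (intro mult_right_mono) auto
      finally show ?thesis
        using tent_nonneg by (auto intro!: ennreal_leI mult_left_mono)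
    qed (simp add: tent_eq_0)
    finally show "(\<integral>\<^sup>+x. ennreal (indicator W x * (tent s z * \<bar>f (x + z) - f x\<bar>)) \<partial>lborel)
        \<le> ennreal (tent s z * (s * V))" .
  qed
  also have "\<dots> = ennreal (c * (s * V))"
    using tent_int V \<open>0 < s\<close> unfolding c_def
    by (subst nn_integral_eq_integral) (auto intro!: AE_I2 mult_nonneg_nonneg tent_nonneg)
  finally have nn: "(\<integral>\<^sup>+x. ennreal (indicator W x * \<bar>c * f x - average s f x\<bar>) \<partial>lborel) \<le> ennreal (c * (s * V))" .
  show "(LINT x|lborel. indicator W x * \<bar>c * f x - average s f x\<bar>) \<le> c * (s * V)"
    using nn c V \<open>0 < s\<close> by (intro integral_real_bounded) auto
  show "integrable lborel (\<lambda>x. indicator W x * \<bar>c * f x - average s f x\<bar>)"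
  proof (rule integrableI_bounded)
    have "(\<integral>\<^sup>+x. ennreal (norm (indicator W x * \<bar>c * f x - average s f x\<bar>)) \<partial>lborel) =
        (\<integral>\<^sup>+x. ennreal (indicator W x * \<bar>c * f x - average s f x\<bar>) \<partial>lborel)"
      by (simp add: indicator_def if_distrib cong: if_cong)
    also have "\<dots> < \<infinity>"
      by (rule le_less_trans[OF nn]) simp
    finally show "(\<integral>\<^sup>+x. ennreal (norm (indicator W x * \<bar>c * f x - average s f x\<bar>)) \<partial>lborel) < \<infinity>" .
  qed measurable
qed

subsection \<open>Compactness\<close>

text \<open>An Arzela-Ascoli argument: the diagonal choice runs over pairs of a scale and a point of
  a countable dense set, and the common Lipschitz constant extends convergence to every point. All
  scales 1 / Suc n share one subsequence, because the scale will later depend on \<epsilon> and the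
  subsequence may not.\<close>

lemma average_convergent_subsequence:
  fixes f :: "nat \<Rightarrow> 'a::euclidean_space \<Rightarrow> real"
  assumes f: "\<And>k. integrable lborel (f k)" and M: "\<And>k. (LINT x|lborel. \<bar>f k x\<bar>) \<le> M"
  obtains r :: "nat \<Rightarrow> nat" where "strict_mono r"
    "\<And>n x. convergent (\<lambda>k. average (1 / Suc n) (f (r k)) x)"
proof -
  have "0 \<le> M"
    by (rule order_trans[OF Bochner_Integration.integral_nonneg M[of 0]]) simp
  obtain Q :: "'a set" where Q: "countable Q" "\<And>X. open X \<Longrightarrow> X \<noteq> {} \<Longrightarrow> \<exists>d\<in>Q. d \<in> X"
    using countable_dense_exists[where 'a = 'a] by blast
  have bound: "norm (average (1 / Suc n) (f k) x) \<le> M" for n k x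
  proof -
    have "\<bar>average (1 / Suc n) (f k) x\<bar> \<le> 1 / Suc n * M"
      by (rule average_bound[OF f M]) simp
    also have "\<dots> \<le> M" using \<open>0 \<le> M\<close> by (intro mult_left_le_one_le) auto
    finally show ?thesis by simp
  qed
  have "countable ((UNIV :: nat set) \<times> Q)" using Q(1) by simp
  then obtain r :: "nat \<Rightarrow> nat" where r: "strict_mono r"
    "\<And>p. p \<in> UNIV \<times> Q \<Longrightarrow> \<exists>l. (\<lambda>k. average (1 / Suc (fst p)) (f (r k)) (snd p)) \<longlonglongrightarrow> l"
    using function_convergent_subsequence[of "UNIV \<times> Q" "\<lambda>k p. average (1 / Suc (fst p)) (f k) (snd p)" M] bound
    by blast
  have "Cauchy (\<lambda>k. average (1 / Suc n) (f (r k)) x)" for n x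
  proof (rule metric_CauchyI)
    fix \<epsilon> :: real assume "0 < \<epsilon>"
    \<comment> \<open>Moving from x to a dense point within d changes every average by at most
      \<epsilon> / 3; the summand 1 covers M = 0.\<close>
    define d where "d = \<epsilon> / (3 * (M + 1))"
    have "0 < d" using \<open>0 < \<epsilon>\<close> \<open>0 \<le> M\<close> by (simp add: d_def)
    then obtain q where q: "q \<in> Q" "dist x q < d"
      using Q(2)[of "ball x d"] by auto
    have "dist x q * M \<le> d * (M + 1)"
      using q(2) \<open>0 \<le> M\<close> \<open>0 < d\<close> by (intro mult_mono) auto
    also have "\<dots> = \<epsilon> / 3" using \<open>0 \<le> M\<close> by (simp add: d_def field_simps)
    finally have close: "\<bar>average (1 / Suc n) (f k) x - average (1 / Suc n) (f k) q\<bar> \<le> \<epsilon> / 3" for k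
      using average_lipschitz[OF f M, of "1 / Suc n" k x q] by (simp add: order_trans)
    have "Cauchy (\<lambda>k. average (1 / Suc n) (f (r k)) q)"
      using r(2)[of "(n, q)"] q(1) by (auto intro: LIMSEQ_imp_Cauchy)
    then obtain N where N: "\<And>k l. N \<le> k \<Longrightarrow> N \<le> l \<Longrightarrow>
        dist (average (1 / Suc n) (f (r k)) q) (average (1 / Suc n) (f (r l)) q) < \<epsilon> / 3"
      using metric_CauchyD[of _ "\<epsilon> / 3"] \<open>0 < \<epsilon>\<close> by (metis divide_pos_pos zero_less_numeral)
    have "dist (average (1 / Suc n) (f (r k)) x) (average (1 / Suc n) (f (r l)) x) < \<epsilon>" if "N \<le> k" "N \<le> l" for k l
      using close[of "r k"] close[of "r l"] N[OF that] unfolding dist_real_def by linarith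
    then show "\<exists>N. \<forall>k\<ge>N. \<forall>l\<ge>N. dist (average (1 / Suc n) (f (r k)) x) (average (1 / Suc n) (f (r l)) x) < \<epsilon>"
      by blast
  qed
  then show thesis
    using r(1) that[of r] by (simp add: Cauchy_convergent_iff)
qed

text \<open>Each function is compared with G / c, where G is the pointwise limit of the averages.
  Its three errors, the mass off K, the averaging error and the distance of the average to G, are at
  most \<epsilon> / 8 each, so two functions differ by at most 6/8 of \<epsilon>.\<close>

lemma BV_class_Cauchy_subsequence:
  fixes f :: "nat \<Rightarrow> 'a::euclidean_space \<Rightarrow> real"
  assumes \<Omega>: "open \<Omega>" "bounded \<Omega>" "Lipschitz_boundary \<Omega>"
    and f: "\<And>k. f k \<in> BV_class \<Omega> M V"
  obtains r :: "nat \<Rightarrow> nat" where "strict_mono r"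
    "\<And>\<epsilon>. 0 < \<epsilon> \<Longrightarrow> \<exists>N. \<forall>k\<ge>N. \<forall>l\<ge>N. (LINT x|lborel. \<bar>f (r k) x - f (r l) x\<bar>) < \<epsilon>"
proof -
  have int: "integrable lborel (f k)" and M: "(LINT x|lborel. \<bar>f k x\<bar>) \<le> M"
    and [measurable]: "f k \<in> borel_measurable borel" for k
    using f[of k] by (auto simp: BV_class_def)
  have "0 \<le> M" "0 \<le> V" using BV_class_nonneg[OF f[of 0]] by auto
  obtain r :: "nat \<Rightarrow> nat" where r: "strict_mono r"
    "\<And>n x. convergent (\<lambda>k. average (1 / Suc n) (f (r k)) x)"
    by (rule average_convergent_subsequence[OF int M]) (rule that)
  have "\<exists>N. \<forall>k\<ge>N. \<forall>l\<ge>N. (LINT x|lborel. \<bar>f (r k) x - f (r l) x\<bar>) < \<epsilon>" if "0 < \<epsilon>" for \<epsilon>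
  proof -
    have \<epsilon>: "0 < \<epsilon> / 8" using \<open>0 < \<epsilon>\<close> by simp
    obtain K where K: "compact K" "K \<subseteq> \<Omega>"
      "\<And>f. f \<in> BV_class \<Omega> M V \<Longrightarrow> (LINT x|lborel. indicator (- K) x * \<bar>f x\<bar>) \<le> \<epsilon> / 8"
      by (rule uniform_tightness[OF \<Omega> \<epsilon>]) (rule that)
    obtain e where e: "0 < e" "(\<Union>x\<in>K. ball x e) \<subseteq> \<Omega>"
      by (rule compact_subset_open_imp_ball_epsilon_subset[OF K(1) \<Omega>(1) K(2)])
    have "0 < min (e / 2) (\<epsilon> / (8 * (V + 1)))" using e(1) \<open>0 < \<epsilon>\<close> \<open>0 \<le> V\<close> by simp
    then obtain n where n: "1 / Suc n < min (e / 2) (\<epsilon> / (8 * (V + 1)))"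
      using nat_approx_posE by blast
    define s where "s = 1 / real (Suc n)"
    have s: "0 < s" "s < e / 2" "s < \<epsilon> / (8 * (V + 1))" using n by (auto simp: s_def)
    have "s * V \<le> s * (V + 1)" using s by (intro mult_left_mono) auto
    also have "\<dots> \<le> \<epsilon> / 8" using s(3) \<open>0 \<le> V\<close> by (simp add: field_simps)
    finally have sV: "s * V \<le> \<epsilon> / 8" .
    \<comment> \<open>The averaging estimate needs an open set, so K is enlarged by e / 2; averages
      of radius s < e / 2 taken on W still see only points of \<Omega>.\<close>
    define W where "W = (\<Union>x\<in>K. ball x (e / 2))"
    have "open W" by (auto simp: W_def)
    then have [measurable]: "W \<in> sets borel" by simp
    have [measurable]: "K \<in> sets borel" using K(1) by (simp add: borel_compact)
    have "K \<subseteq> W" using e(1) by (force simp: W_def)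
    have W: "ball x s \<subseteq> \<Omega>" if "x \<in> W" for x
    proof
      fix y assume "y \<in> ball x s"
      obtain z where z: "z \<in> K" "dist z x < e / 2" using \<open>x \<in> W\<close> by (auto simp: W_def)
      have "dist z y < e"
        using dist_triangle[of z y x] z(2) \<open>y \<in> ball x s\<close> s(2) by simp
      then have "y \<in> ball z e" by simp
      then show "y \<in> \<Omega>" using e(2) z(1) by blast
    qed
    have "bounded W"
      using W s(1) by (intro bounded_subset[OF \<Omega>(2)]) force
    define c where "c = (LINT z|lborel. tent s (z :: 'a))"
    have "0 < c" unfolding c_def by (rule tent_integral_pos[OF s(1)])
    define g where "g k = average s (f (r k))" for k
    define G where "G x = lim (\<lambda>k. g k x)" for x
    have g_lim: "(\<lambda>k. g k x) \<longlonglongrightarrow> G x" for x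
      using r(2)[of n x] unfolding g_def G_def s_def by (simp add: convergent_LIMSEQ_iff)
    have [measurable]: "g k \<in> borel_measurable borel" for k
      unfolding g_def by measurable
    have [measurable]: "G \<in> borel_measurable borel"
      using g_lim by (rule borel_measurable_LIMSEQ_metric[rotated]) simp
    have g_bound: "\<bar>g k x\<bar> \<le> s * M" for k x
      unfolding g_def using s(1) by (intro average_bound int M) simp
    have G_bound: "\<bar>G x\<bar> \<le> s * M" for x
      using tendsto_rabs[OF g_lim[of x]] g_bound by (intro LIMSEQ_le_const2) auto
    \<comment> \<open>On the bounded set W a constant is an integrable dominating function, so
      pointwise convergence of the averages already gives convergence in L^1(W).\<close>
    have int_W: "integrable lborel (\<lambda>x. indicator W x * (2 * (s * M)))"
      using \<open>bounded W\<close>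
      by (intro integrable_mult_left integrable_real_indicator emeasure_bounded_finite) auto
    have dom: "norm (indicator W x * \<bar>g k x - G x\<bar>) \<le> indicator W x * (2 * (s * M))" for k x
      using g_bound[of k x] G_bound[of x] by (auto simp: indicator_def)
    have int_gG: "integrable lborel (\<lambda>x. indicator W x * \<bar>g k x - G x\<bar>)" for k
    proof (rule Bochner_Integration.integrable_bound[OF int_W])
      show "AE x in lborel. norm (indicator W x * \<bar>g k x - G x\<bar>) \<le> norm (indicator W x * (2 * (s * M)))"
        by (intro AE_I2 order_trans[OF dom]) (simp only: real_norm_def abs_ge_self)
    qed measurable
    have "(\<lambda>k. LINT x|lborel. indicator W x * \<bar>g k x - G x\<bar>) \<longlonglongrightarrow> (LINT x|(lborel :: 'a measure). 0 :: real)"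
    proof (rule integral_dominated_convergence[of _ _ _ "\<lambda>x. indicator W x * (2 * (s * M))"])
      show "AE x in lborel. (\<lambda>k. indicator W x * \<bar>g k x - G x\<bar>) \<longlonglongrightarrow> 0"
        using g_lim LIM_zero by (intro AE_I2 tendsto_mult_right_zero tendsto_rabs_zero) blast
    qed (use dom int_W in auto)
    then have "(\<lambda>k. LINT x|lborel. indicator W x * \<bar>g k x - G x\<bar>) \<longlonglongrightarrow> 0" by simp
    then obtain N where N: "\<And>k. N \<le> k \<Longrightarrow> (LINT x|lborel. indicator W x * \<bar>g k x - G x\<bar>) < c * (\<epsilon> / 8)"
      using \<open>0 < c\<close> \<open>0 < \<epsilon>\<close> order_tendstoD(2)[of _ 0 sequentially "c * (\<epsilon> / 8)"]
      by (auto simp: eventually_sequentially)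
    \<comment> \<open>T k bounds the distance to G / c on K and \<bar>f (r k)\<bar> off K; either
      way T k + T l dominates the difference. The division by c accounts for the unnormalised
      kernel.\<close>
    define T where "T k x = indicator (- K) x * \<bar>f (r k) x\<bar>
      + (indicator W x * \<bar>c * f (r k) x - g k x\<bar> + indicator W x * \<bar>g k x - G x\<bar>) / c" for k x
    have int_K: "integrable lborel (\<lambda>x. indicator (- K) x * \<bar>f (r k) x\<bar>)" for k
      by (intro integrable_indicator_mult_abs int) simp
    have int_c: "integrable lborel (\<lambda>x. indicator W x * \<bar>c * f (r k) x - g k x\<bar>)"
      and le_c: "(LINT x|lborel. indicator W x * \<bar>c * f (r k) x - g k x\<bar>) \<le> c * (s * V)" for k
      unfolding c_def g_def by (rule average_approximation[OF f \<open>open W\<close> s(1) W], assumption)+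
    have T_int: "integrable lborel (T k)" for k
      unfolding T_def[abs_def] by (intro Bochner_Integration.integrable_add integrable_divide int_K int_c int_gG)
    have T_le: "(LINT x|lborel. T k x) \<le> 3 / 8 * \<epsilon>" if "N \<le> k" for k
    proof -
      have "(LINT x|lborel. T k x) = (LINT x|lborel. indicator (- K) x * \<bar>f (r k) x\<bar>)
        + ((LINT x|lborel. indicator W x * \<bar>c * f (r k) x - g k x\<bar>)
          + (LINT x|lborel. indicator W x * \<bar>g k x - G x\<bar>)) / c"
        unfolding T_def using int_K int_c int_gG by simp
      also have "\<dots> \<le> \<epsilon> / 8 + (c * (\<epsilon> / 8) + c * (\<epsilon> / 8)) / c"
        using K(3)[OF f] order_trans[OF le_c mult_left_mono[OF sV]] N[OF that] \<open>0 < c\<close>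
        by (intro add_mono divide_right_mono) (auto intro: less_imp_le)
      also have "\<dots> = 3 / 8 * \<epsilon>" using \<open>0 < c\<close> by (simp add: field_simps)
      finally show ?thesis .
    qed
    have pointwise: "\<bar>f (r k) x - f (r l) x\<bar> \<le> T k x + T l x" for k l x
    proof (cases "x \<in> K")
      case True
      then have "x \<in> W" using \<open>K \<subseteq> W\<close> by blast
      have "c * \<bar>f (r k) x - f (r l) x\<bar> = \<bar>c * f (r k) x - c * f (r l) x\<bar>"
        using \<open>0 < c\<close> by (simp add: abs_mult flip: right_diff_distrib)
      also have "\<dots> \<le> (\<bar>c * f (r k) x - g k x\<bar> + \<bar>g k x - G x\<bar>) + (\<bar>c * f (r l) x - g l x\<bar> + \<bar>g l x - G x\<bar>)"
        by linarith
      also have "\<dots> = c * (T k x + T l x)"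
        using True \<open>x \<in> W\<close> \<open>0 < c\<close> by (simp add: T_def field_simps)
      finally show ?thesis using \<open>0 < c\<close> by simp
    next
      case False
      have "\<bar>f (r k) x\<bar> \<le> T k x" for k
        using False \<open>0 < c\<close> by (simp add: T_def)
      from this[of k] this[of l] show ?thesis by linarith
    qed
    have "(LINT x|lborel. \<bar>f (r k) x - f (r l) x\<bar>) < \<epsilon>" if "N \<le> k" "N \<le> l" for k l
    proof -
      have "(LINT x|lborel. \<bar>f (r k) x - f (r l) x\<bar>) \<le> (LINT x|lborel. T k x + T l x)"
        using pointwise int T_int by (intro integral_mono) auto
      also have "\<dots> = (LINT x|lborel. T k x) + (LINT x|lborel. T l x)"
        using T_int by simp
      also have "\<dots> < \<epsilon>" using T_le[OF that(1)] T_le[OF that(2)] \<open>0 < \<epsilon>\<close> by linarith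
      finally show ?thesis .
    qed
    then show ?thesis by blast
  qed
  then show thesis using r(1) that by blast
qed

text \<open>The Riesz-Fischer argument: a rapidly Cauchy subsequence converges almost everywhere,
  and Fatou's lemma shows that the whole sequence tends to its limit in L^1.\<close>

lemma L1_complete:
  fixes f :: "nat \<Rightarrow> 'a \<Rightarrow> real"
  assumes int: "\<And>k. integrable M (f k)"
    and Cauchy: "\<And>\<epsilon>. 0 < \<epsilon> \<Longrightarrow> \<exists>N. \<forall>k\<ge>N. \<forall>l\<ge>N. (LINT x|M. \<bar>f k x - f l x\<bar>) < \<epsilon>"
  obtains v where "integrable M v" "(\<lambda>k. LINT x|M. \<bar>f k x - v x\<bar>) \<longlonglongrightarrow> 0"
proof -
  have [measurable]: "f k \<in> borel_measurable M" for k using int by auto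
  have nn_eq: "(\<integral>\<^sup>+x. ennreal \<bar>f k x - f l x\<bar> \<partial>M) = ennreal (LINT x|M. \<bar>f k x - f l x\<bar>)" for k l
    using int by (intro nn_integral_eq_integral) auto
  have "\<forall>n. \<exists>N. \<forall>k\<ge>N. \<forall>l\<ge>N. (LINT x|M. \<bar>f k x - f l x\<bar>) < (1 / 2) ^ n"
    using Cauchy by simp
  then obtain N where N: "\<And>n k l. N n \<le> k \<Longrightarrow> N n \<le> l \<Longrightarrow> (LINT x|M. \<bar>f k x - f l x\<bar>) < (1 / 2) ^ n"
    by metis
  (* r n and r (n + 1) both lie above N n, so the telescoping series of f (r n) converges absolutely. *)
  define r where "r n = n + (\<Sum>i\<le>n. N i)" for n
  have r_ge: "N n \<le> r n" "N n \<le> r (Suc n)" "n \<le> r n" for n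
    using member_le_sum[of n "{..n}" N] by (auto simp: r_def)
  have "(\<integral>\<^sup>+x. (\<Sum>n. ennreal \<bar>f (r (Suc n)) x - f (r n) x\<bar>) \<partial>M)
      = (\<Sum>n. \<integral>\<^sup>+x. ennreal \<bar>f (r (Suc n)) x - f (r n) x\<bar> \<partial>M)"
    by (rule nn_integral_suminf) measurable
  also have "\<dots> \<le> (\<Sum>n. ennreal ((1 / 2) ^ n))"
    unfolding nn_eq by (intro suminf_le ennreal_leI less_imp_le N r_ge) auto
  also have "\<dots> < \<infinity>"
    by (subst suminf_ennreal2) auto
  finally have "AE x in M. (\<Sum>n. ennreal \<bar>f (r (Suc n)) x - f (r n) x\<bar>) \<noteq> \<infinity>"
    by (intro nn_integral_PInf_AE) auto
  then have conv: "AE x in M. convergent (\<lambda>n. f (r n) x)"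
  proof eventually_elim
    case (elim x)
    then have "summable (\<lambda>n. \<bar>f (r (Suc n)) x - f (r n) x\<bar>)"
      by (intro summable_suminf_not_top) auto
    then have "summable (\<lambda>n. f (r (Suc n)) x - f (r n) x)"
      by (rule summable_rabs_cancel)
    then show ?case
      by (simp add: summable_iff_convergent sum_lessThan_telescope[of "\<lambda>n. f (r n) x"]
          convergent_diff_const_right_iff)
  qed
  define v where "v x = lim (\<lambda>n. f (r n) x)" for x
  have [measurable]: "v \<in> borel_measurable M"
    unfolding v_def[abs_def] by measurable
  \<comment> \<open>Fatou along the subsequence with k fixed. Nonnegative integrals are used because
    integrability of v is itself deduced from this bound.\<close>
  have bound: "(\<integral>\<^sup>+x. ennreal \<bar>f k x - v x\<bar> \<partial>M) \<le> ennreal \<epsilon>"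
    if K: "\<forall>k\<ge>K. \<forall>l\<ge>K. (LINT x|M. \<bar>f k x - f l x\<bar>) < \<epsilon>" "K \<le> k" for k K \<epsilon>
  proof -
    have "AE x in M. ennreal \<bar>f k x - v x\<bar> = liminf (\<lambda>n. ennreal \<bar>f k x - f (r n) x\<bar>)"
      using conv
    proof eventually_elim
      case (elim x)
      then have "(\<lambda>n. f (r n) x) \<longlonglongrightarrow> v x"
        by (simp add: v_def convergent_LIMSEQ_iff)
      then have "(\<lambda>n. ennreal \<bar>f k x - f (r n) x\<bar>) \<longlonglongrightarrow> ennreal \<bar>f k x - v x\<bar>"
        by (intro tendsto_intros)
      from lim_imp_Liminf[OF _ this] show ?case by simp
    qed
    then have "(\<integral>\<^sup>+x. ennreal \<bar>f k x - v x\<bar> \<partial>M) = (\<integral>\<^sup>+x. liminf (\<lambda>n. ennreal \<bar>f k x - f (r n) x\<bar>) \<partial>M)"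
      by (rule nn_integral_cong_AE)
    also have "\<dots> \<le> liminf (\<lambda>n. \<integral>\<^sup>+x. ennreal \<bar>f k x - f (r n) x\<bar> \<partial>M)"
      by (rule nn_integral_liminf) measurable
    also have "\<dots> \<le> ennreal \<epsilon>"
    proof (rule Liminf_le)
      show "\<forall>\<^sub>F n in sequentially. (\<integral>\<^sup>+x. ennreal \<bar>f k x - f (r n) x\<bar> \<partial>M) \<le> ennreal \<epsilon>"
        unfolding nn_eq eventually_sequentially
        using K r_ge(3) by (intro exI[of _ K] allI impI ennreal_leI less_imp_le) (blast intro: order_trans)
    qed simp
    finally show ?thesis .
  qed
  obtain K where "\<forall>k\<ge>K. \<forall>l\<ge>K. (LINT x|M. \<bar>f k x - f l x\<bar>) < 1"
    using Cauchy[of 1] by auto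
  from bound[OF this order_refl] have "integrable M (\<lambda>x. f K x - v x)"
    by (intro integrableI_bounded) (auto intro: le_less_trans)
  from Bochner_Integration.integrable_diff[OF int[of K] this] have "integrable M v" by simp
  moreover have "(\<lambda>k. LINT x|M. \<bar>f k x - v x\<bar>) \<longlonglongrightarrow> 0"
  proof (rule LIMSEQ_I)
    fix \<epsilon> :: real assume "0 < \<epsilon>"
    then obtain K where K: "\<forall>k\<ge>K. \<forall>l\<ge>K. (LINT x|M. \<bar>f k x - f l x\<bar>) < \<epsilon> / 2"
      using Cauchy[of "\<epsilon> / 2"] by auto
    have "norm ((LINT x|M. \<bar>f k x - v x\<bar>) - 0) < \<epsilon>" if "K \<le> k" for k
    proof -
      have "(LINT x|M. \<bar>f k x - v x\<bar>) \<le> \<epsilon> / 2"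
        using \<open>0 < \<epsilon>\<close> by (intro integral_real_bounded bound[OF K that]) auto
      then show ?thesis using \<open>0 < \<epsilon>\<close> by simp
    qed
    then show "\<exists>K. \<forall>k\<ge>K. norm ((LINT x|M. \<bar>f k x - v x\<bar>) - 0) < \<epsilon>" by blast
  qed
  ultimately show thesis by (rule that)
qed

corollary BV_class_compact:
  fixes f :: "nat \<Rightarrow> 'a::euclidean_space \<Rightarrow> real"
  assumes "open \<Omega>" "bounded \<Omega>" "Lipschitz_boundary \<Omega>" and f: "\<And>k. f k \<in> BV_class \<Omega> M V"
  obtains r :: "nat \<Rightarrow> nat" and v where "strict_mono r" "integrable lborel v"
    "(\<lambda>k. LINT x|lborel. \<bar>f (r k) x - v x\<bar>) \<longlonglongrightarrow> 0"
proof -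
  obtain r :: "nat \<Rightarrow> nat" where r: "strict_mono r"
    "\<And>\<epsilon>. 0 < \<epsilon> \<Longrightarrow> \<exists>N. \<forall>k\<ge>N. \<forall>l\<ge>N. (LINT x|lborel. \<bar>f (r k) x - f (r l) x\<bar>) < \<epsilon>"
    by (rule BV_class_Cauchy_subsequence[OF assms]) (rule that)
  have "integrable lborel (f (r k))" for k using f by (simp add: BV_class_def)
  then obtain v where "integrable lborel v" "(\<lambda>k. LINT x|lborel. \<bar>f (r k) x - v x\<bar>) \<longlonglongrightarrow> 0"
    by (rule L1_complete[OF _ r(2)]) (assumption, rule that)
  with r(1) show thesis by (rule that)
qed

subsection \<open>Magnetic bounded variation\<close>

lemma
  fixes h :: "'a::euclidean_space \<Rightarrow> real"
  assumes "open \<Omega>" and [measurable]: "h \<in> borel_measurable borel" and "\<And>x. x \<notin> \<Omega> \<Longrightarrow> h x = 0"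
  shows integral_lebesgue_on_eq_lborel: "integral\<^sup>L (lebesgue_on \<Omega>) h = integral\<^sup>L lborel h"
    and integrable_lebesgue_on_iff_lborel: "integrable (lebesgue_on \<Omega>) h \<longleftrightarrow> integrable lborel h"
proof -
  have eq: "(\<lambda>x. indicator \<Omega> x *\<^sub>R h x) = h"
    using assms(3) by (intro ext) (auto simp: indicator_def)
  have \<Omega>: "\<Omega> \<inter> space lebesgue \<in> sets lebesgue" using \<open>open \<Omega>\<close> by simp
  show "integral\<^sup>L (lebesgue_on \<Omega>) h = integral\<^sup>L lborel h"
    unfolding integral_restrict_space[OF \<Omega>] eq by (rule integral_completion) simp
  show "integrable (lebesgue_on \<Omega>) h \<longleftrightarrow> integrable lborel h"
    unfolding integrable_restrict_space[OF \<Omega>] eq by (rule integrable_completion) simp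
qed

text \<open>This serves the L^1 limits, which are not known to vanish outside \<Omega>; for them
  restriction to \<Omega> gives an inequality.\<close>

lemma integral_lebesgue_on_le_lborel:
  fixes h :: "'a::euclidean_space \<Rightarrow> real"
  assumes "open \<Omega>" "integrable lborel h"
  shows "integrable (lebesgue_on \<Omega>) h"
    and "(LINT x|lebesgue_on \<Omega>. \<bar>h x\<bar>) \<le> (LINT x|lborel. \<bar>h x\<bar>)"
proof -
  have [measurable]: "h \<in> borel_measurable borel" "\<Omega> \<in> sets borel" using assms by auto
  have "integrable lebesgue h" using assms(2) by (simp add: integrable_completion)
  then show "integrable (lebesgue_on \<Omega>) h"
    using \<open>open \<Omega>\<close> by (simp add: integrable_restrict_space integrable_mult_indicator del: scaleR_conv_of_real real_scaleR_def)
  have "(LINT x|lebesgue_on \<Omega>. \<bar>h x\<bar>) = (LINT x|lebesgue_on \<Omega>. indicator \<Omega> x * \<bar>h x\<bar>)"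
    by (intro Bochner_Integration.integral_cong) auto
  also have "\<dots> = (LINT x|lborel. indicator \<Omega> x * \<bar>h x\<bar>)"
    using \<open>open \<Omega>\<close> by (intro integral_lebesgue_on_eq_lborel) auto
  also have "\<dots> \<le> (LINT x|lborel. \<bar>h x\<bar>)"
    using assms by (intro integral_mono integrable_indicator_mult_abs) (auto simp: indicator_def)
  finally show "(LINT x|lebesgue_on \<Omega>. \<bar>h x\<bar>) \<le> (LINT x|lborel. \<bar>h x\<bar>)" .
qed

text \<open>\<open>BV_class\<close> bounds its fields pointwise and \<open>test_fields\<close>
  essentially; this inclusion carries variation bounds over to \<open>BV_class\<close>.\<close>

lemma test_fieldsI:
  assumes "open \<Omega>" "\<phi> \<in> Cc_infinity \<Omega>" "\<And>x. norm (\<phi> x) \<le> 1"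
  shows "\<phi> \<in> test_fields \<Omega>"
proof -
  have [measurable]: "\<phi> \<in> borel_measurable borel"
    using Cc_infinity_continuous[OF assms(2)] by (rule borel_measurable_continuous_onI)
  have "\<phi> \<in> borel_measurable lebesgue" by (simp add: measurable_completion)
  then have [measurable]: "\<phi> \<in> borel_measurable (lebesgue_on \<Omega>)"
    by (rule measurable_restrict_space1)
  have "Linf_norm \<Omega> \<phi> \<le> 1"
    unfolding Linf_norm_def using assms(3)
    by (intro esssup_I AE_I2) (auto simp: one_ereal_def)
  then show ?thesis using assms(2) by (simp add: test_fields_def)
qed

lemma locally_bounded_compact_image:
  assumes "locally_bounded f" "compact K"
  shows "bounded (f ` K)"
proof -
  obtain U where U: "\<And>x. open (U x)" "\<And>x. x \<in> U x" "\<And>x. bounded (f ` U x)"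
    using assms(1) unfolding locally_bounded_def by metis
  have "K \<subseteq> (\<Union>x\<in>K. U x)" using U(2) by blast
  then obtain D where D: "D \<subseteq> K" "finite D" "K \<subseteq> (\<Union>x\<in>D. U x)"
    by (rule compactE_image[OF assms(2) U(1)]) (rule that)
  then have "bounded (\<Union>x\<in>D. f ` U x)" using U(3) by (intro bounded_UN) auto
  then show ?thesis by (rule bounded_subset) (use D(3) in blast)
qed

text \<open>One formula serves both variations: (p, q) = (Re u, Im u) gives the first and (Im u, -
  Re u), the parts of - i u, the second.\<close>

definition magnetic_pairing ::
    "('a::euclidean_space \<Rightarrow> 'a) \<Rightarrow> 'a set \<Rightarrow> ('a \<Rightarrow> real) \<Rightarrow> ('a \<Rightarrow> real) \<Rightarrow> ('a \<Rightarrow> 'a) \<Rightarrow> real" where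
  "magnetic_pairing A \<Omega> p q \<phi> = (LINT x|lebesgue_on \<Omega>. p x * divergence \<phi> x - (A x \<bullet> \<phi> x) * q x)"

lemma set_integral_lebesgue_eq:
  fixes h :: "'a::euclidean_space \<Rightarrow> 'b::{banach, second_countable_topology}"
  assumes "open \<Omega>"
  shows "(LINT x:\<Omega>|lebesgue. h x) = (LINT x|lebesgue_on \<Omega>. h x)"
    and "set_integrable lebesgue \<Omega> h \<longleftrightarrow> integrable (lebesgue_on \<Omega>) h"
  using assms by (simp_all add: set_lebesgue_integral_def set_integrable_def integral_restrict_space integrable_restrict_space)

lemma C_var_eq_SUP_pairing:
  assumes "open \<Omega>"
  shows "C1_var A \<Omega> u = (SUP \<phi>\<in>test_fields \<Omega>. ereal (magnetic_pairing A \<Omega> (\<lambda>x. Re (u x)) (\<lambda>x. Im (u x)) \<phi>))"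
    and "C2_var A \<Omega> u = (SUP \<phi>\<in>test_fields \<Omega>. ereal (magnetic_pairing A \<Omega> (\<lambda>x. Im (u x)) (\<lambda>x. - Re (u x)) \<phi>))"
  using assms by (simp_all add: C1_var_def C2_var_def magnetic_pairing_def set_integral_lebesgue_eq)

lemma borel_measurable_lebesgue_on:
  "h \<in> borel_measurable borel \<Longrightarrow> h \<in> borel_measurable (lebesgue_on \<Omega>)"
  by (intro measurable_restrict_space1 measurable_completion) simp

lemma magnetic_pairing_integrable:
  assumes A: "A \<in> borel_measurable lebesgue" "\<forall>x\<in>\<Omega>. norm (A x) \<le> B" "0 \<le> B"
    and \<phi>: "\<phi> \<in> Cc_infinity \<Omega>"
    and p: "integrable (lebesgue_on \<Omega>) p" and q: "integrable (lebesgue_on \<Omega>) q"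
  shows "integrable (lebesgue_on \<Omega>) (\<lambda>x. p x * divergence \<phi> x)"
    and "integrable (lebesgue_on \<Omega>) (\<lambda>x. (A x \<bullet> \<phi> x) * q x)"
proof -
  have [measurable]: "divergence \<phi> \<in> borel_measurable (lebesgue_on \<Omega>)" "\<phi> \<in> borel_measurable (lebesgue_on \<Omega>)"
    using divergence_continuous[OF \<phi>] Cc_infinity_continuous[OF \<phi>]
    by (auto intro!: borel_measurable_lebesgue_on borel_measurable_continuous_onI)
  have [measurable]: "A \<in> borel_measurable (lebesgue_on \<Omega>)"
    using A(1) by (rule measurable_restrict_space1)
  obtain D where D: "0 \<le> D" "\<And>x. \<bar>divergence \<phi> x\<bar> \<le> D"
    using divergence_bounded[OF \<phi>] by metis
  obtain E where E: "0 \<le> E" "\<And>x. norm (\<phi> x) \<le> E"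
    using Cc_infinity_bounded[OF \<phi>] by metis
  show "integrable (lebesgue_on \<Omega>) (\<lambda>x. p x * divergence \<phi> x)"
    using p D(2) by (intro integrable_mult_bounded[where B = D]) auto
  have "\<bar>A x \<bullet> \<phi> x\<bar> \<le> B * E" if "x \<in> \<Omega>" for x
    using bspec[OF A(2) that] E(2)[of x] \<open>0 \<le> B\<close>
    by (intro order_trans[OF Cauchy_Schwarz_ineq2] mult_mono) auto
  then have "integrable (lebesgue_on \<Omega>) (\<lambda>x. q x * (A x \<bullet> \<phi> x))"
    using q by (intro integrable_mult_bounded[where B = "B * E"]) auto
  then show "integrable (lebesgue_on \<Omega>) (\<lambda>x. (A x \<bullet> \<phi> x) * q x)"
    by (simp add: mult.commute)
qed

text \<open>The almost everywhere equal Borel function is cut off by the indicator of \<Omega>, so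
  that it vanishes outside. In the variation bound M + B * M, the first term bounds the magnetic
  pairing and the second the term A \<bullet> \<phi> q.\<close>

lemma BV_class_representative:
  fixes \<Omega> :: "'a::euclidean_space set"
  assumes "open \<Omega>"
    and A: "A \<in> borel_measurable lebesgue" "\<forall>x\<in>\<Omega>. norm (A x) \<le> B" "0 \<le> B"
    and p: "integrable (lebesgue_on \<Omega>) p" "(LINT x|lebesgue_on \<Omega>. \<bar>p x\<bar>) \<le> M"
    and q: "integrable (lebesgue_on \<Omega>) q" "(LINT x|lebesgue_on \<Omega>. \<bar>q x\<bar>) \<le> M"
    and pq: "\<And>\<phi>. \<phi> \<in> test_fields \<Omega> \<Longrightarrow> magnetic_pairing A \<Omega> p q \<phi> \<le> M"
  obtains f where "f \<in> BV_class \<Omega> M (M + B * M)" "AE x in lebesgue_on \<Omega>. p x = f x"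
proof -
  have [measurable]: "\<Omega> \<in> sets borel" and \<Omega>: "\<Omega> \<inter> space lebesgue \<in> sets lebesgue"
    using \<open>open \<Omega>\<close> by auto
  have "integrable lebesgue (\<lambda>x. indicator \<Omega> x *\<^sub>R p x)"
    using p(1) unfolding integrable_restrict_space[OF \<Omega>] .
  then have "(\<lambda>x. indicator \<Omega> x *\<^sub>R p x) \<in> borel_measurable (completion lborel)" by auto
  then obtain g where [measurable]: "g \<in> borel_measurable borel"
    and g: "AE x in lborel. indicator \<Omega> x *\<^sub>R p x = g x"
    by (auto dest!: completion_ex_borel_measurable_real)
  define f where "f x = indicator \<Omega> x * g x" for x
  have [measurable]: "f \<in> borel_measurable borel" unfolding f_def[abs_def] by measurable
  have f_0: "f x = 0" if "x \<notin> \<Omega>" for x using that by (simp add: f_def)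
  have "AE x in lebesgue. x \<in> \<Omega> \<longrightarrow> p x = f x"
    unfolding AE_completion_iff using g by eventually_elim (auto simp: f_def)
  then have pf: "AE x in lebesgue_on \<Omega>. p x = f x"
    unfolding AE_restrict_space_iff[OF \<Omega>] .
  have [measurable]: "p \<in> borel_measurable (lebesgue_on \<Omega>)" using p(1) by auto
  have f_meas: "f \<in> borel_measurable (lebesgue_on \<Omega>)" by (rule borel_measurable_lebesgue_on) measurable
  have "f \<in> BV_class \<Omega> M (M + B * M)"
    unfolding BV_class_def
  proof (intro CollectI conjI allI impI ballI f_0)
    have "integrable (lebesgue_on \<Omega>) f"
      using p(1) f_meas pf by (subst integrable_cong_AE[of _ _ p]) auto
    then show "integrable lborel f"
      by (subst integrable_lebesgue_on_iff_lborel[symmetric, OF \<open>open \<Omega>\<close> _ f_0]) auto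
    have "(LINT x|lborel. \<bar>f x\<bar>) = (LINT x|lebesgue_on \<Omega>. \<bar>f x\<bar>)"
      using f_0 by (intro integral_lebesgue_on_eq_lborel[symmetric] \<open>open \<Omega>\<close>) auto
    also have "\<dots> = (LINT x|lebesgue_on \<Omega>. \<bar>p x\<bar>)"
      using pf f_meas by (intro integral_cong_AE) auto
    finally show "(LINT x|lborel. \<bar>f x\<bar>) \<le> M" using p(2) by simp
    fix \<phi> :: "'a \<Rightarrow> 'a" assume \<phi>: "\<phi> \<in> Cc_infinity \<Omega>" "\<forall>x. norm (\<phi> x) \<le> 1"
    have [measurable]: "divergence \<phi> \<in> borel_measurable borel"
      using divergence_continuous[OF \<phi>(1)] by (rule borel_measurable_continuous_onI)
    have div_meas: "divergence \<phi> \<in> borel_measurable (lebesgue_on \<Omega>)"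
      by (rule borel_measurable_lebesgue_on) measurable
    note int = magnetic_pairing_integrable[OF A \<phi>(1) p(1) q(1)]
    have "(LINT x|lborel. f x * divergence \<phi> x) = (LINT x|lebesgue_on \<Omega>. f x * divergence \<phi> x)"
      using f_0 by (intro integral_lebesgue_on_eq_lborel[symmetric] \<open>open \<Omega>\<close>) auto
    also have "\<dots> = (LINT x|lebesgue_on \<Omega>. p x * divergence \<phi> x)"
      using pf f_meas div_meas by (intro integral_cong_AE) auto
    \<comment> \<open>The ordinary variation pairing is recovered by adding the magnetic term
      back.\<close>
    also have "\<dots> = magnetic_pairing A \<Omega> p q \<phi> + (LINT x|lebesgue_on \<Omega>. (A x \<bullet> \<phi> x) * q x)"
      unfolding magnetic_pairing_def using int by simp
    also have "\<dots> \<le> M + B * M"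
    proof (rule add_mono)
      show "magnetic_pairing A \<Omega> p q \<phi> \<le> M"
        using \<phi> by (intro pq test_fieldsI \<open>open \<Omega>\<close>) auto
      have "(LINT x|lebesgue_on \<Omega>. (A x \<bullet> \<phi> x) * q x) \<le> (LINT x|lebesgue_on \<Omega>. B * \<bar>q x\<bar>)"
      proof (rule integral_mono)
        fix x assume "x \<in> space (lebesgue_on \<Omega>)"
        then have "x \<in> \<Omega>" by simp
        have "\<bar>A x \<bullet> \<phi> x\<bar> \<le> B * 1"
          using bspec[OF A(2) \<open>x \<in> \<Omega>\<close>] \<phi>(2) \<open>0 \<le> B\<close>
          by (intro order_trans[OF Cauchy_Schwarz_ineq2] mult_mono) auto
        from mult_right_mono[OF this, of "\<bar>q x\<bar>"] have "\<bar>(A x \<bullet> \<phi> x) * q x\<bar> \<le> B * \<bar>q x\<bar>"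
          by (simp add: abs_mult)
        then show "(A x \<bullet> \<phi> x) * q x \<le> B * \<bar>q x\<bar>" by linarith
      qed (use int q(1) in auto)
      also have "\<dots> \<le> B * M" using q(2) \<open>0 \<le> B\<close> by (simp add: mult_left_mono)
      finally show "(LINT x|lebesgue_on \<Omega>. (A x \<bullet> \<phi> x) * q x) \<le> B * M" .
    qed
    finally show "(LINT x|lborel. f x * divergence \<phi> x) \<le> M + B * M" .
  qed
  with pf show thesis by (rule that[rotated])
qed

text \<open>For a fixed field the pairing is continuous in L^1, since the divergence and A \<bullet>
  \<phi> are bounded on \<Omega>. A bound valid along the sequence thus survives for each field,
  hence for the suprema; this is the lower semicontinuity.\<close>

lemma magnetic_pairing_tendsto:
  fixes p q :: "nat \<Rightarrow> 'a::euclidean_space \<Rightarrow> real"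
  assumes A: "A \<in> borel_measurable lebesgue" "\<forall>x\<in>\<Omega>. norm (A x) \<le> B" "0 \<le> B"
    and \<phi>: "\<phi> \<in> Cc_infinity \<Omega>"
    and p: "\<And>k. integrable (lebesgue_on \<Omega>) (p k)" "integrable (lebesgue_on \<Omega>) p'"
      "(\<lambda>k. LINT x|lebesgue_on \<Omega>. \<bar>p k x - p' x\<bar>) \<longlonglongrightarrow> 0"
    and q: "\<And>k. integrable (lebesgue_on \<Omega>) (q k)" "integrable (lebesgue_on \<Omega>) q'"
      "(\<lambda>k. LINT x|lebesgue_on \<Omega>. \<bar>q k x - q' x\<bar>) \<longlonglongrightarrow> 0"
  shows "(\<lambda>k. magnetic_pairing A \<Omega> (p k) (q k) \<phi>) \<longlonglongrightarrow> magnetic_pairing A \<Omega> p' q' \<phi>"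
proof -
  obtain D where D: "0 \<le> D" "\<And>x. \<bar>divergence \<phi> x\<bar> \<le> D"
    using divergence_bounded[OF \<phi>] by metis
  obtain E where E: "0 \<le> E" "\<And>x. norm (\<phi> x) \<le> E"
    using Cc_infinity_bounded[OF \<phi>] by metis
  note int = magnetic_pairing_integrable[OF A \<phi>]
  have bound: "\<bar>magnetic_pairing A \<Omega> (p k) (q k) \<phi> - magnetic_pairing A \<Omega> p' q' \<phi>\<bar>
      \<le> D * (LINT x|lebesgue_on \<Omega>. \<bar>p k x - p' x\<bar>) + B * E * (LINT x|lebesgue_on \<Omega>. \<bar>q k x - q' x\<bar>)" for k
  proof -
    let ?h = "\<lambda>x. (p k x * divergence \<phi> x - (A x \<bullet> \<phi> x) * q k x) - (p' x * divergence \<phi> x - (A x \<bullet> \<phi> x) * q' x)"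
    have int_k: "integrable (lebesgue_on \<Omega>) (\<lambda>x. p k x * divergence \<phi> x - (A x \<bullet> \<phi> x) * q k x)"
      and int': "integrable (lebesgue_on \<Omega>) (\<lambda>x. p' x * divergence \<phi> x - (A x \<bullet> \<phi> x) * q' x)"
      using int[OF p(1) q(1)] int[OF p(2) q(2)] by simp_all
    have diff: "magnetic_pairing A \<Omega> (p k) (q k) \<phi> - magnetic_pairing A \<Omega> p' q' \<phi> = (LINT x|lebesgue_on \<Omega>. ?h x)"
      unfolding magnetic_pairing_def by (rule Bochner_Integration.integral_diff[OF int_k int', symmetric])
    have "\<bar>magnetic_pairing A \<Omega> (p k) (q k) \<phi> - magnetic_pairing A \<Omega> p' q' \<phi>\<bar> \<le> (LINT x|lebesgue_on \<Omega>. \<bar>?h x\<bar>)"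
      unfolding diff by (rule integral_abs_bound)
    also have "\<dots> \<le> (LINT x|lebesgue_on \<Omega>. D * \<bar>p k x - p' x\<bar> + B * E * \<bar>q k x - q' x\<bar>)"
    proof (rule integral_mono)
      show "integrable (lebesgue_on \<Omega>) (\<lambda>x. \<bar>?h x\<bar>)"
        by (intro integrable_abs Bochner_Integration.integrable_diff[OF int_k int'])
      show "integrable (lebesgue_on \<Omega>) (\<lambda>x. D * \<bar>p k x - p' x\<bar> + B * E * \<bar>q k x - q' x\<bar>)"
        by (intro Bochner_Integration.integrable_add integrable_mult_right integrable_abs
            Bochner_Integration.integrable_diff p q)
      fix x assume "x \<in> space (lebesgue_on \<Omega>)"
      then have "x \<in> \<Omega>" by simp
      have A_bd: "\<bar>A x \<bullet> \<phi> x\<bar> \<le> B * E"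
        using bspec[OF A(2) \<open>x \<in> \<Omega>\<close>] E(2)[of x] \<open>0 \<le> B\<close>
        by (intro order_trans[OF Cauchy_Schwarz_ineq2] mult_mono) auto
      have eq: "?h x = divergence \<phi> x * (p k x - p' x) - (A x \<bullet> \<phi> x) * (q k x - q' x)"
        by (simp add: algebra_simps)
      have "\<bar>?h x\<bar> \<le> \<bar>divergence \<phi> x\<bar> * \<bar>p k x - p' x\<bar> + \<bar>A x \<bullet> \<phi> x\<bar> * \<bar>q k x - q' x\<bar>"
        unfolding eq abs_mult[symmetric] by (rule abs_triangle_ineq4)
      also have "\<dots> \<le> D * \<bar>p k x - p' x\<bar> + B * E * \<bar>q k x - q' x\<bar>"
        by (intro add_mono mult_right_mono D A_bd) auto
      finally show "\<bar>?h x\<bar> \<le> D * \<bar>p k x - p' x\<bar> + B * E * \<bar>q k x - q' x\<bar>" .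
    qed
    also have "\<dots> = D * (LINT x|lebesgue_on \<Omega>. \<bar>p k x - p' x\<bar>) + B * E * (LINT x|lebesgue_on \<Omega>. \<bar>q k x - q' x\<bar>)"
    proof -
      have "integrable (lebesgue_on \<Omega>) (\<lambda>x. \<bar>p k x - p' x\<bar>)" "integrable (lebesgue_on \<Omega>) (\<lambda>x. \<bar>q k x - q' x\<bar>)"
        by (intro integrable_abs Bochner_Integration.integrable_diff p q)+
      then show ?thesis by simp
    qed
    finally show ?thesis .
  qed
  have "(\<lambda>k. D * (LINT x|lebesgue_on \<Omega>. \<bar>p k x - p' x\<bar>) + B * E * (LINT x|lebesgue_on \<Omega>. \<bar>q k x - q' x\<bar>)) \<longlonglongrightarrow> D * 0 + B * E * 0"
    by (intro tendsto_intros p(3) q(3))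
  then have lim: "(\<lambda>k. D * (LINT x|lebesgue_on \<Omega>. \<bar>p k x - p' x\<bar>) + B * E * (LINT x|lebesgue_on \<Omega>. \<bar>q k x - q' x\<bar>)) \<longlonglongrightarrow> 0"
    by simp
  have "(\<lambda>k. magnetic_pairing A \<Omega> (p k) (q k) \<phi> - magnetic_pairing A \<Omega> p' q' \<phi>) \<longlonglongrightarrow> 0"
    by (rule Lim_null_comparison[OF always_eventually lim]) (simp add: bound)
  then show ?thesis by (rule LIM_zero_cancel)
qed

text \<open>The zero field makes both suprema nonnegative, so each summand of the norm is bounded by
  M separately, without subtraction of extended reals.\<close>

lemma BV_norm_le_D:
  fixes u :: "'a::euclidean_space \<Rightarrow> complex"
  assumes "open \<Omega>" "u \<in> BV A \<Omega>" "BV_norm A \<Omega> u \<le> ereal M"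
  shows "integrable (lebesgue_on \<Omega>) (\<lambda>x. Re (u x))" "integrable (lebesgue_on \<Omega>) (\<lambda>x. Im (u x))"
    and "(LINT x|lebesgue_on \<Omega>. \<bar>Re (u x)\<bar>) \<le> M" "(LINT x|lebesgue_on \<Omega>. \<bar>Im (u x)\<bar>) \<le> M"
    and "\<And>\<phi>. \<phi> \<in> test_fields \<Omega> \<Longrightarrow> magnetic_pairing A \<Omega> (\<lambda>x. Re (u x)) (\<lambda>x. Im (u x)) \<phi> \<le> M"
    and "\<And>\<phi>. \<phi> \<in> test_fields \<Omega> \<Longrightarrow> magnetic_pairing A \<Omega> (\<lambda>x. Im (u x)) (\<lambda>x. - Re (u x)) \<phi> \<le> M"
proof -
  have "integrable (lebesgue_on \<Omega>) u"
    using assms(1,2) by (simp add: BV_def set_integral_lebesgue_eq)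
  then show Re: "integrable (lebesgue_on \<Omega>) (\<lambda>x. Re (u x))" and Im: "integrable (lebesgue_on \<Omega>) (\<lambda>x. Im (u x))"
    by auto
  define I where "I = (LINT x|lebesgue_on \<Omega>. \<bar>Re (u x)\<bar> + \<bar>Im (u x)\<bar>)"
  have I: "I = (LINT x|lebesgue_on \<Omega>. \<bar>Re (u x)\<bar>) + (LINT x|lebesgue_on \<Omega>. \<bar>Im (u x)\<bar>)"
    unfolding I_def using Re Im by simp
  have nn: "0 \<le> (LINT x|lebesgue_on \<Omega>. \<bar>Re (u x)\<bar>)" "0 \<le> (LINT x|lebesgue_on \<Omega>. \<bar>Im (u x)\<bar>)"
    by simp_all
  have "(\<lambda>_. 0) \<in> test_fields \<Omega>"
    using \<open>open \<Omega>\<close> by (intro test_fieldsI) (auto simp: Cc_infinity_def C_k_const)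
  moreover have "magnetic_pairing A \<Omega> p q (\<lambda>_. 0) = 0" for p q
    by (simp add: magnetic_pairing_def divergence_def)
  ultimately have C_nonneg: "0 \<le> C1_var A \<Omega> u" "0 \<le> C2_var A \<Omega> u"
    unfolding C_var_eq_SUP_pairing[OF \<open>open \<Omega>\<close>]
    by (auto intro!: SUP_upper2[of "\<lambda>_. 0"] simp flip: zero_ereal_def)
  have sum: "ereal I + (C1_var A \<Omega> u + C2_var A \<Omega> u) \<le> ereal M"
    using assms(3) \<open>open \<Omega>\<close> by (simp add: BV_norm_def magnetic_variation_def set_integral_lebesgue_eq I_def)
  have "ereal I \<le> ereal M"
    using order_trans[OF add_increasing2[OF add_nonneg_nonneg[OF C_nonneg] order_refl] sum] .
  then show "(LINT x|lebesgue_on \<Omega>. \<bar>Re (u x)\<bar>) \<le> M" "(LINT x|lebesgue_on \<Omega>. \<bar>Im (u x)\<bar>) \<le> M"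
    using I nn unfolding ereal_less_eq by linarith+
  have "0 \<le> ereal I" using I nn by simp
  then have C_le: "C1_var A \<Omega> u + C2_var A \<Omega> u \<le> ereal M"
    using order_trans[OF add_increasing[OF _ order_refl] sum] by blast
  have "C1_var A \<Omega> u \<le> ereal M"
    using order_trans[OF add_increasing2[OF C_nonneg(2) order_refl] C_le] .
  moreover have "C2_var A \<Omega> u \<le> ereal M"
    using order_trans[OF add_increasing[OF C_nonneg(1) order_refl] C_le] .
  ultimately show "magnetic_pairing A \<Omega> (\<lambda>x. Re (u x)) (\<lambda>x. Im (u x)) \<phi> \<le> M"
      "magnetic_pairing A \<Omega> (\<lambda>x. Im (u x)) (\<lambda>x. - Re (u x)) \<phi> \<le> M" if "\<phi> \<in> test_fields \<Omega>" for \<phi>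
    using that unfolding C_var_eq_SUP_pairing[OF \<open>open \<Omega>\<close>] SUP_le_iff by auto
qed

theorem lemma3p14:
  fixes \<Omega> :: "(real ^ 'n) set"
    and A :: "real ^ 'n \<Rightarrow> real ^ 'n"
    and u :: "nat \<Rightarrow> real ^ 'n \<Rightarrow> complex"
  assumes "open \<Omega>" and "connected \<Omega>" and "\<Omega> \<noteq> {}" and "bounded \<Omega>"
    and "Lipschitz_boundary \<Omega>"
    and "A \<in> borel_measurable lebesgue" and "locally_bounded A"
    and "\<And>k. u k \<in> BV A \<Omega>"
    and "\<exists>M::real. \<forall>k. BV_norm A \<Omega> (u k) \<le> ereal M"
  shows "\<exists>r :: nat \<Rightarrow> nat. strict_mono r \<and>
    (\<exists>v \<in> BV A \<Omega>. (\<lambda>k. LINT x:\<Omega>|lebesgue. cmod (u (r k) x - v x)) \<longlonglongrightarrow> 0)"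
proof -
  obtain M where "\<And>k. BV_norm A \<Omega> (u k) \<le> ereal M" using assms(9) by blast
  note u = BV_norm_le_D[OF \<open>open \<Omega>\<close> assms(8) this]
  have "bounded (A ` closure \<Omega>)"
    using assms(4,7) by (intro locally_bounded_compact_image) (simp_all add: compact_closure)
  then obtain B where "0 < B" "\<forall>x\<in>A ` closure \<Omega>. norm x \<le> B"
    by (auto simp: bounded_pos)
  then have B: "0 \<le> B" "\<forall>x\<in>\<Omega>. norm (A x) \<le> B"
    using closure_subset[of \<Omega>] by auto
  note A = assms(6) B(2,1)
  have neg: "integrable (lebesgue_on \<Omega>) (\<lambda>x. - Re (u k x))" "(LINT x|lebesgue_on \<Omega>. \<bar>- Re (u k x)\<bar>) \<le> M" for k
    using u(1,3) by simp_all
  have "\<exists>f. f \<in> BV_class \<Omega> M (M + B * M) \<and> (AE x in lebesgue_on \<Omega>. Re (u k x) = f x)" for k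
    by (rule BV_class_representative[OF \<open>open \<Omega>\<close> A u(1,3) u(2,4) u(5)]) auto
  then obtain f where f: "\<And>k. f k \<in> BV_class \<Omega> M (M + B * M)" "\<And>k. AE x in lebesgue_on \<Omega>. Re (u k x) = f k x"
    by metis
  \<comment> \<open>The imaginary part is treated as the real part of - i u, whose imaginary part is
    - Re u.\<close>
  have "\<exists>g. g \<in> BV_class \<Omega> M (M + B * M) \<and> (AE x in lebesgue_on \<Omega>. Im (u k x) = g x)" for k
    by (rule BV_class_representative[OF \<open>open \<Omega>\<close> A u(2,4) neg u(6)]) auto
  then obtain g where g: "\<And>k. g k \<in> BV_class \<Omega> M (M + B * M)" "\<And>k. AE x in lebesgue_on \<Omega>. Im (u k x) = g k x"
    by metis
  obtain r1 :: "nat \<Rightarrow> nat" and v1 where r1: "strict_mono r1" "integrable lborel v1"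
    "(\<lambda>k. LINT x|lborel. \<bar>f (r1 k) x - v1 x\<bar>) \<longlonglongrightarrow> 0"
    by (rule BV_class_compact[OF \<open>open \<Omega>\<close> \<open>bounded \<Omega>\<close> \<open>Lipschitz_boundary \<Omega>\<close> f(1)]) (rule that)
  \<comment> \<open>The second extraction starts from the subsequence r1, so the real parts still
    converge along the composition.\<close>
  obtain r2 :: "nat \<Rightarrow> nat" and v2 where r2: "strict_mono r2" "integrable lborel v2"
    "(\<lambda>k. LINT x|lborel. \<bar>g (r1 (r2 k)) x - v2 x\<bar>) \<longlonglongrightarrow> 0"
    by (rule BV_class_compact[OF \<open>open \<Omega>\<close> \<open>bounded \<Omega>\<close> \<open>Lipschitz_boundary \<Omega>\<close>, of "\<lambda>k. g (r1 k)"])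
       (rule g(1), rule that)
  define r where "r k = r1 (r2 k)" for k
  have "strict_mono r"
    using r1(1) r2(1) by (auto simp: strict_mono_def r_def)
  define v where "v x = Complex (v1 x) (v2 x)" for x
  have int_v: "integrable (lebesgue_on \<Omega>) v1" "integrable (lebesgue_on \<Omega>) v2"
    using integral_lebesgue_on_le_lborel(1)[OF \<open>open \<Omega>\<close>] r1(2) r2(2) by auto
  \<comment> \<open>Convergence of the Borel representatives on the whole space is transferred back
    to the original functions on \<Omega>, for real and imaginary parts alike.\<close>
  have conv: "(\<lambda>k. LINT x|lebesgue_on \<Omega>. \<bar>p k x - w x\<bar>) \<longlonglongrightarrow> 0"
    if h: "\<And>k. h k \<in> BV_class \<Omega> M (M + B * M)" "\<And>k. AE x in lebesgue_on \<Omega>. p k x = h k x"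
      and p: "\<And>k. integrable (lebesgue_on \<Omega>) (p k)"
      and w: "integrable lborel w" "(\<lambda>k. LINT x|lborel. \<bar>h k x - w x\<bar>) \<longlonglongrightarrow> 0" for p h w
  proof (rule tendsto_sandwich[OF _ _ tendsto_const w(2)])
    have "(LINT x|lebesgue_on \<Omega>. \<bar>p k x - w x\<bar>) \<le> (LINT x|lborel. \<bar>h k x - w x\<bar>)" for k
    proof -
      have int: "integrable lborel (h k)" using h(1) by (simp add: BV_class_def)
      note int_on = integral_lebesgue_on_le_lborel(1)[OF \<open>open \<Omega>\<close>]
      have "(LINT x|lebesgue_on \<Omega>. \<bar>p k x - w x\<bar>) = (LINT x|lebesgue_on \<Omega>. \<bar>h k x - w x\<bar>)"
        using h(2)[of k] p[of k] int_on[OF int] int_on[OF w(1)]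
        by (intro integral_cong_AE) auto
      also have "\<dots> \<le> (LINT x|lborel. \<bar>h k x - w x\<bar>)"
        using int w(1) by (intro integral_lebesgue_on_le_lborel(2) \<open>open \<Omega>\<close>) auto
      finally show ?thesis .
    qed
    then show "\<forall>\<^sub>F k in sequentially. (LINT x|lebesgue_on \<Omega>. \<bar>p k x - w x\<bar>) \<le> (LINT x|lborel. \<bar>h k x - w x\<bar>)"
      by simp
  qed simp
  have Re_conv: "(\<lambda>k. LINT x|lebesgue_on \<Omega>. \<bar>Re (u (r k) x) - v1 x\<bar>) \<longlonglongrightarrow> 0"
    using LIMSEQ_subseq_LIMSEQ[OF r1(3) r2(1)]
    by (intro conv[of "\<lambda>k. f (r k)"] f u r1(2)) (simp add: r_def o_def)
  have Im_conv: "(\<lambda>k. LINT x|lebesgue_on \<Omega>. \<bar>Im (u (r k) x) - v2 x\<bar>) \<longlonglongrightarrow> 0"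
    using r2(3) by (intro conv[of "\<lambda>k. g (r k)"] g u r2(2)) (simp add: r_def)
  have "integrable (lebesgue_on \<Omega>) v"
    unfolding v_def[abs_def] Complex_eq
    using int_v by (intro Bochner_Integration.integrable_add integrable_mult_right integrable_of_real)
  then have "set_integrable lebesgue \<Omega> v"
    by (simp add: set_integral_lebesgue_eq \<open>open \<Omega>\<close>)
  have neg_conv: "(\<lambda>k. LINT x|lebesgue_on \<Omega>. \<bar>- Re (u (r k) x) - - v1 x\<bar>) \<longlonglongrightarrow> 0"
    using Re_conv by (simp add: abs_minus_commute)
  have C: "C1_var A \<Omega> v \<le> ereal M" "C2_var A \<Omega> v \<le> ereal M"
    unfolding C_var_eq_SUP_pairing[OF \<open>open \<Omega>\<close>]
  proof (safe intro!: SUP_least)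
    fix \<phi> assume "\<phi> \<in> test_fields \<Omega>"
    then have \<phi>: "\<phi> \<in> Cc_infinity \<Omega>" by (simp add: test_fields_def)
    have "magnetic_pairing A \<Omega> v1 v2 \<phi> \<le> M"
      using magnetic_pairing_tendsto[OF A \<phi> u(1) int_v(1) Re_conv u(2) int_v(2) Im_conv]
      by (rule LIMSEQ_le_const2) (use u(5)[OF \<open>\<phi> \<in> test_fields \<Omega>\<close>] in auto)
    then show "ereal (magnetic_pairing A \<Omega> (\<lambda>x. Re (v x)) (\<lambda>x. Im (v x)) \<phi>) \<le> ereal M"
      by (simp add: v_def)
    have "magnetic_pairing A \<Omega> v2 (\<lambda>x. - v1 x) \<phi> \<le> M"
      using magnetic_pairing_tendsto[OF A \<phi> u(2) int_v(2) Im_conv neg(1) _ neg_conv] int_v(1)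
      by (intro LIMSEQ_le_const2) (use u(6)[OF \<open>\<phi> \<in> test_fields \<Omega>\<close>] in auto)
    then show "ereal (magnetic_pairing A \<Omega> (\<lambda>x. Im (v x)) (\<lambda>x. - Re (v x)) \<phi>) \<le> ereal M"
      by (simp add: v_def)
  qed
  have "magnetic_variation A \<Omega> v \<le> ereal M + ereal M"
    unfolding magnetic_variation_def by (intro add_mono C)
  also have "\<dots> < \<infinity>" by simp
  finally have "v \<in> BV A \<Omega>"
    using \<open>set_integrable lebesgue \<Omega> v\<close> by (simp add: BV_def)
  moreover have "(\<lambda>k. LINT x:\<Omega>|lebesgue. cmod (u (r k) x - v x)) \<longlonglongrightarrow> 0"
  proof (rule tendsto_sandwich[OF _ _ tendsto_const])
    have "(LINT x:\<Omega>|lebesgue. cmod (u (r k) x - v x)) \<le>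
        (LINT x|lebesgue_on \<Omega>. \<bar>Re (u (r k) x) - v1 x\<bar>) + (LINT x|lebesgue_on \<Omega>. \<bar>Im (u (r k) x) - v2 x\<bar>)" for k
    proof -
      have u_int: "integrable (lebesgue_on \<Omega>) (u (r k))"
        using assms(8)[of "r k"] \<open>open \<Omega>\<close> by (simp add: BV_def set_integral_lebesgue_eq)
      have "(LINT x|lebesgue_on \<Omega>. cmod (u (r k) x - v x)) \<le>
          (LINT x|lebesgue_on \<Omega>. \<bar>Re (u (r k) x) - v1 x\<bar> + \<bar>Im (u (r k) x) - v2 x\<bar>)"
      proof (rule integral_mono)
        show "integrable (lebesgue_on \<Omega>) (\<lambda>x. cmod (u (r k) x - v x))"
          using u_int \<open>integrable (lebesgue_on \<Omega>) v\<close> by simp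
        show "integrable (lebesgue_on \<Omega>) (\<lambda>x. \<bar>Re (u (r k) x) - v1 x\<bar> + \<bar>Im (u (r k) x) - v2 x\<bar>)"
          using u(1,2)[of "r k"] int_v by simp
        show "cmod (u (r k) x - v x) \<le> \<bar>Re (u (r k) x) - v1 x\<bar> + \<bar>Im (u (r k) x) - v2 x\<bar>" for x
          using cmod_le[of "u (r k) x - v x"] by (simp add: v_def)
      qed
      also have "\<dots> = (LINT x|lebesgue_on \<Omega>. \<bar>Re (u (r k) x) - v1 x\<bar>) + (LINT x|lebesgue_on \<Omega>. \<bar>Im (u (r k) x) - v2 x\<bar>)"
        using u(1,2)[of "r k"] int_v by simp
      finally show ?thesis by (simp add: set_integral_lebesgue_eq \<open>open \<Omega>\<close>)
    qed
    then show "\<forall>\<^sub>F k in sequentially. (LINT x:\<Omega>|lebesgue. cmod (u (r k) x - v x)) \<le>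
        (LINT x|lebesgue_on \<Omega>. \<bar>Re (u (r k) x) - v1 x\<bar>) + (LINT x|lebesgue_on \<Omega>. \<bar>Im (u (r k) x) - v2 x\<bar>)"
      by simp
    show "\<forall>\<^sub>F k in sequentially. 0 \<le> (LINT x:\<Omega>|lebesgue. cmod (u (r k) x - v x))"
      by (simp add: set_integral_lebesgue_eq \<open>open \<Omega>\<close>)
    show "(\<lambda>k. (LINT x|lebesgue_on \<Omega>. \<bar>Re (u (r k) x) - v1 x\<bar>) + (LINT x|lebesgue_on \<Omega>. \<bar>Im (u (r k) x) - v2 x\<bar>)) \<longlonglongrightarrow> 0"
      using tendsto_add[OF Re_conv Im_conv] by simp
  qed
  ultimately show ?thesis using \<open>strict_mono r\<close> by blast
qed

end
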